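(* For all $1\le k\le n$ and any $1<\delta\le 2$, letting $q=\lceil \frac{2k^2}{\delta-1}\rceil$, a $\delta$-balanced $(n,k,q)$-splitter of size $\frac{k^{O(1)}\log n}{(\delta-1)^{O(1)}}$ can be constructed deterministically in time $\frac{k^{O(1)}\,n\log n}{(\delta-1)^{O(1)}}$, where the implied constants are absolute.
   Context: $[n]=\{1,\dots,n\}$ and $\binom{[n]}{k}$ is the family of $k$-element subsets of $[n]$. For a family (multiset) $H$ of functions from $[n]$ to $[q]$ with $k\le q$ and $S\in\binom{[n]}{k}$, $split(S)$ is the number of $h\in H$ that are one-to-one on $S$. For $\delta\ge1$, $H$ is a $\delta$-balanced $(n,k,q)$-splitter if there is a real $T>0$ with $T/\delta\le split(S)\le\delta T$ for all $S\in\binom{[n]}{k}$. The size of $H$ is its number of functions; constructing it means outputting the list of all its functions.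
   Formalization: In both bounds log n is replaced by ln(n+1), because at n=k=1 log n is 0 while any balanced splitter is non-empty; for n≥2 the two agree up to an absolute constant factor. *)

theory Defs
  imports Complex_Main "HOL-Library.Multiset" "HOL-Library.FuncSet"
begin

text \<open>\<open>[m]\<close> is \<open>{1..m}\<close>. Functions \<open>[n] \<rightarrow> [q]\<close> are extensional, so that a multiset counts each
  function with its multiplicity, independently of values outside \<open>[n]\<close>.\<close>

definition split :: "(nat \<Rightarrow> nat) multiset \<Rightarrow> nat set \<Rightarrow> nat" where
  "split H S = size {#h \<in># H. inj_on h S#}"

definition balanced_splitter ::
  "real \<Rightarrow> nat \<Rightarrow> nat \<Rightarrow> nat \<Rightarrow> (nat \<Rightarrow> nat) multiset \<Rightarrow> bool" where
  "balanced_splitter \<delta> n k q H \<longleftrightarrow>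
     \<delta> \<ge> 1 \<and> k \<le> q \<and> set_mset H \<subseteq> {1..n} \<rightarrow>\<^sub>E {1..q} \<and>
     (\<exists>T::real. T > 0 \<and>
       (\<forall>S. S \<subseteq> {1..n} \<and> card S = k \<longrightarrow>
          T / \<delta> \<le> real (split H S) \<and> real (split H S) \<le> \<delta> * T))"

text \<open>Running time is measured on a deterministic word RAM, programmed by structured code: finitely
  many registers per program, a word-addressed memory, a write-only output stream, and unit-cost
  operations on words. A word holds a number between \<open>0\<close> and \<open>M\<close>; a run that would produce a larger
  number has no outcome. The real input \<open>\<delta>\<close> does not fit into a word; it can only be compared
  with ratios of words: \<open>Ratio_le x y\<close> tests \<open>x / y \<le> \<delta>\<close>, for register contents \<open>x\<close>, \<open>y > 0\<close>.\<close>

type_synonym reg = nat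

datatype arith = Add | Sub | Mul | Div | Mod

fun arith_val :: "arith \<Rightarrow> nat \<Rightarrow> nat \<Rightarrow> nat" where
  "arith_val Add x y = x + y"
| "arith_val Sub x y = x - y"
| "arith_val Mul x y = x * y"
| "arith_val Div x y = x div y"
| "arith_val Mod x y = x mod y"

datatype cond = Less reg reg | Ratio_le reg reg

datatype com =
    Skip
  | Const reg nat
  | Arith arith reg reg reg
  | Load reg reg
  | Store reg reg
  | Output reg
  | Seq com com
  | If cond com com
  | While cond com

record state =
  regs :: "reg \<Rightarrow> nat"
  mem :: "nat \<Rightarrow> nat"
  outp :: "nat list"

fun cond_val :: "real \<Rightarrow> cond \<Rightarrow> state \<Rightarrow> bool" where
  "cond_val \<delta> (Less i j) s \<longleftrightarrow> regs s i < regs s j"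
| "cond_val \<delta> (Ratio_le i j) s \<longleftrightarrow> real (regs s i) \<le> \<delta> * real (regs s j)"

text \<open>\<open>exec \<delta> M p s t s'\<close>: started in \<open>s\<close>, the program \<open>p\<close> halts in \<open>s'\<close> after exactly \<open>t\<close> steps.
  Every instruction and every evaluation of a test takes one step. In \<open>Load\<close> and \<open>Store\<close> the second
  register contains the address.\<close>

inductive exec :: "real \<Rightarrow> nat \<Rightarrow> com \<Rightarrow> state \<Rightarrow> nat \<Rightarrow> state \<Rightarrow> bool" for \<delta> M where
  Skip: "exec \<delta> M Skip s 1 s"
| Const: "v \<le> M \<Longrightarrow> exec \<delta> M (Const i v) s 1 (s\<lparr>regs := (regs s)(i := v)\<rparr>)"
| Arith: "v = arith_val f (regs s a) (regs s b) \<Longrightarrow> v \<le> M \<Longrightarrow>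
    exec \<delta> M (Arith f i a b) s 1 (s\<lparr>regs := (regs s)(i := v)\<rparr>)"
| Load: "exec \<delta> M (Load i a) s 1 (s\<lparr>regs := (regs s)(i := mem s (regs s a))\<rparr>)"
| Store: "exec \<delta> M (Store i a) s 1 (s\<lparr>mem := (mem s)(regs s a := regs s i)\<rparr>)"
| Output: "exec \<delta> M (Output i) s 1 (s\<lparr>outp := outp s @ [regs s i]\<rparr>)"
| Seq: "exec \<delta> M p s t s' \<Longrightarrow> exec \<delta> M p' s' t' s'' \<Longrightarrow> exec \<delta> M (Seq p p') s (t + t') s''"
| If_True: "cond_val \<delta> b s \<Longrightarrow> exec \<delta> M p s t s' \<Longrightarrow> exec \<delta> M (If b p p') s (1 + t) s'"
| If_False: "\<not> cond_val \<delta> b s \<Longrightarrow> exec \<delta> M p' s t s' \<Longrightarrow> exec \<delta> M (If b p p') s (1 + t) s'"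
| While_False: "\<not> cond_val \<delta> b s \<Longrightarrow> exec \<delta> M (While b p) s 1 s"
| While_True: "cond_val \<delta> b s \<Longrightarrow> exec \<delta> M p s t s' \<Longrightarrow> exec \<delta> M (While b p) s' t' s'' \<Longrightarrow>
    exec \<delta> M (While b p) s (1 + t + t') s''"

lemma exec_deterministic:
  "exec \<delta> M p s t s' \<Longrightarrow> exec \<delta> M p s u s'' \<Longrightarrow> t = u \<and> s' = s''"
proof (induction arbitrary: u s'' rule: exec.induct)
  case Skip
  then show ?case by (auto elim: exec.cases)
next
  case Const
  from Const.prems show ?case by cases auto
next
  case Arith
  from Arith.prems Arith.hyps show ?case by cases auto
next
  case Load
  then show ?case by cases auto
next
  case Store
  then show ?case by cases auto
next
  case Output
  then show ?case by cases auto
next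
  case Seq
  from Seq.prems show ?case by cases (use Seq.IH in blast)
next
  case If_True
  from If_True.prems show ?case by cases (use If_True in blast)+
next
  case If_False
  from If_False.prems show ?case by cases (use If_False in blast)+
next
  case While_False
  from While_False.prems show ?case by cases (use While_False in auto)
next
  case While_True
  from While_True.prems show ?case by cases (use While_True in blast)+
qed

definition init_state :: "nat \<Rightarrow> nat \<Rightarrow> state" where
  "init_state n k = \<lparr>regs = (\<lambda>_. 0)(0 := n, 1 := k), mem = (\<lambda>_. 0), outp = []\<rparr>"

text \<open>A list of functions is output as the concatenation of their value tables.\<close>

definition tables :: "nat \<Rightarrow> (nat \<Rightarrow> nat) list \<Rightarrow> nat list" where
  "tables n hs = concat (map (\<lambda>h. map h [1..<Suc n]) hs)"

definition constructs ::
  "com \<Rightarrow> nat \<Rightarrow> nat \<Rightarrow> nat \<Rightarrow> real \<Rightarrow> (nat \<Rightarrow> nat) multiset \<Rightarrow> nat \<Rightarrow> bool" where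
  "constructs p M n k \<delta> H t \<longleftrightarrow>
     (\<exists>s hs. exec \<delta> M p (init_state n k) t s \<and> mset hs = H \<and> outp s = tables n hs)"

end

theory Submission
  imports Defs
begin

text \<open>Let \<open>m\<close> be about \<open>sqrt n\<close>, and \<open>N = q m\<close>. For \<open>i < q\<close>, map \<open>x \<in> [n]\<close> to the symbol
  \<open>x mod m + i * (x div m) < N\<close>; two distinct elements have equal symbols for at most one \<open>i\<close>, since two
  distinct lines meet at most once. Compose these maps with \<open>L = O(q log N)\<close> functions \<open>g\<^sub>j\<close> from \<open>N\<close> symbols to
  \<open>q\<close> values, any two symbols agreeing under at most \<open>2 L / q\<close> of them. Then two elements of \<open>[n]\<close> collide
  under a fraction of at most \<open>3 / q\<close> of the \<open>q L\<close> compositions, and a union bound over the pairs in a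
  \<open>k\<close>-set gives the splitter.

  The \<open>g\<^sub>j\<close> come from derandomization: give each pair of symbols the weight 2 to the number of its agreements so
  far, and choose the values of the next function one by one, each minimizing the weight of the new
  agreements. Each new function multiplies the total weight by at most \<open>1 + 1 / q\<close>, so no pair agrees too
  often. All weights are integers polynomial in \<open>n + q\<close>, and since \<open>m\<^sup>2 = O(n)\<close> the table of \<open>N\<^sup>2\<close> weights
  fits into the time bound.\<close>

subsection \<open>Weakest preconditions with running time\<close>

text \<open>\<open>t\<close> is the clock reading at the start, so time bounds compose along
  \<open>Seq\<close> by passing the clock on. A run has to exist: termination and the absence of
  word overflow are part of the claim.\<close>

definition wp :: "real \<Rightarrow> nat \<Rightarrow> com \<Rightarrow> (state \<Rightarrow> nat \<Rightarrow> bool) \<Rightarrow> state \<Rightarrow> nat \<Rightarrow> bool" where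
  "wp \<delta> M p Q s t \<longleftrightarrow> (\<exists>u s'. exec \<delta> M p s u s' \<and> Q s' (t + u))"

abbreviation Seq' (infixr ";;" 60) where "p ;; p' \<equiv> Seq p p'"

lemma wp_simps [simp]:
  "wp \<delta> M Skip Q s t \<longleftrightarrow> Q s (Suc t)"
  "wp \<delta> M (Const i v) Q s t \<longleftrightarrow> v \<le> M \<and> Q (s\<lparr>regs := (regs s)(i := v)\<rparr>) (Suc t)"
  "wp \<delta> M (Arith f i a b) Q s t \<longleftrightarrow> arith_val f (regs s a) (regs s b) \<le> M \<and>
    Q (s\<lparr>regs := (regs s)(i := arith_val f (regs s a) (regs s b))\<rparr>) (Suc t)"
  "wp \<delta> M (Load i a) Q s t \<longleftrightarrow> Q (s\<lparr>regs := (regs s)(i := mem s (regs s a))\<rparr>) (Suc t)"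
  "wp \<delta> M (Store i a) Q s t \<longleftrightarrow> Q (s\<lparr>mem := (mem s)(regs s a := regs s i)\<rparr>) (Suc t)"
  "wp \<delta> M (Output i) Q s t \<longleftrightarrow> Q (s\<lparr>outp := outp s @ [regs s i]\<rparr>) (Suc t)"
  unfolding wp_def by (fastforce elim: exec.cases intro: exec.intros)+

inductive_cases exec_SeqE: "exec \<delta> M (p ;; p') s t s'"
inductive_cases exec_IfE: "exec \<delta> M (If b p p') s t s'"

lemma wp_Seq [simp]: "wp \<delta> M (p ;; p') Q s t \<longleftrightarrow> wp \<delta> M p (wp \<delta> M p' Q) s t"
proof
  show "wp \<delta> M (p ;; p') Q s t \<Longrightarrow> wp \<delta> M p (wp \<delta> M p' Q) s t"
    unfolding wp_def by (auto elim!: exec_SeqE simp: add.assoc)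
  show "wp \<delta> M p (wp \<delta> M p' Q) s t \<Longrightarrow> wp \<delta> M (p ;; p') Q s t"
    unfolding wp_def by (metis exec.Seq add.assoc)
qed

lemma wp_If [simp]:
  "wp \<delta> M (If b p p') Q s t \<longleftrightarrow> (if cond_val \<delta> b s then wp \<delta> M p Q s (Suc t) else wp \<delta> M p' Q s (Suc t))"
proof
  show "wp \<delta> M (If b p p') Q s t \<Longrightarrow>
      if cond_val \<delta> b s then wp \<delta> M p Q s (Suc t) else wp \<delta> M p' Q s (Suc t)"
    unfolding wp_def by (auto elim!: exec_IfE) blast+
  assume *: "if cond_val \<delta> b s then wp \<delta> M p Q s (Suc t) else wp \<delta> M p' Q s (Suc t)"
  then obtain u s' where "exec \<delta> M (if cond_val \<delta> b s then p else p') s u s'" "Q s' (Suc t + u)"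
    unfolding wp_def by (auto split: if_splits)
  then show "wp \<delta> M (If b p p') Q s t"
    unfolding wp_def
    by (intro exI[of _ "1 + u"] exI[of _ s'])
      (auto intro: exec.If_True[simplified] exec.If_False[simplified] split: if_splits)
qed

lemma wp_While_unfold:
  assumes "if cond_val \<delta> b s then wp \<delta> M p (wp \<delta> M (While b p) Q) s (Suc t) else Q s (Suc t)"
  shows "wp \<delta> M (While b p) Q s t"
proof (cases "cond_val \<delta> b s")
  case True
  then obtain u s' u' s'' where "exec \<delta> M p s u s'" "exec \<delta> M (While b p) s' u' s''" "Q s'' (Suc t + u + u')"
    using assms unfolding wp_def by auto
  then show ?thesis
    using exec.While_True[OF True, of M p u s' u' s''] unfolding wp_def
    by (intro exI[of _ "1 + u + u'"] exI[of _ s'']) (simp add: add.assoc)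
next
  case False
  then show ?thesis
    using assms exec.While_False[OF False, of M p] unfolding wp_def
    by (intro exI[of _ 1] exI[of _ s]) simp
qed

lemma wp_mono:
  assumes "wp \<delta> M p Q s t" "\<And>s' t'. Q s' t' \<Longrightarrow> Q' s' t'"
  shows "wp \<delta> M p Q' s t"
  using assms unfolding wp_def by blast

text \<open>For loops with a known number \<open>e\<close> of passes: \<open>v\<close> is a ghost
  counter, a pass costs at most \<open>c\<close> steps plus one for its test, and the final
  \<open>1\<close> pays for the failing test. The proof is by induction on the number of passes
  left.\<close>

lemma wp_While:
  assumes init: "I 0 s"
    and cond: "\<And>v s. I v s \<Longrightarrow> v \<le> e \<Longrightarrow> cond_val \<delta> b s \<longleftrightarrow> v < e"
    and body: "\<And>v s t. I v s \<Longrightarrow> v < e \<Longrightarrow> wp \<delta> M p (\<lambda>s' t'. I (Suc v) s' \<and> t' \<le> t + c) s t"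
    and post: "\<And>s' t'. I e s' \<Longrightarrow> t' \<le> t + e * Suc c + 1 \<Longrightarrow> Q s' t'"
  shows "wp \<delta> M (While b p) Q s t"
proof -
  have "wp \<delta> M (While b p) (\<lambda>s' t'. I e s' \<and> t' \<le> t + d * Suc c + 1) s t"
    if "I v s" "v + d = e" for v d s t
    using that
  proof (induction d arbitrary: v s t)
    case 0
    then show ?case by (intro wp_While_unfold) (simp add: cond)
  next
    case (Suc d)
    have "wp \<delta> M p (wp \<delta> M (While b p) (\<lambda>s' t'. I e s' \<and> t' \<le> t + Suc d * Suc c + 1)) s (Suc t)"
    proof (rule wp_mono[OF body[OF Suc.prems(1)]])
      fix s' t' assume "I (Suc v) s' \<and> t' \<le> Suc t + c"
      then show "wp \<delta> M (While b p) (\<lambda>s' t'. I e s' \<and> t' \<le> t + Suc d * Suc c + 1) s' t'"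
        using Suc.IH[of "Suc v" s' t'] Suc.prems(2) by (auto intro: wp_mono)
    qed (use Suc.prems in simp)
    then show ?case
      using Suc.prems by (intro wp_While_unfold) (simp add: cond)
  qed
  from this[OF init add_0] show ?thesis
    by (rule wp_mono) (auto intro: post)
qed

subsection \<open>The greedy choice of the inner functions\<close>

text \<open>Cell \<open>r * N + c\<close> of the memory \<open>\<mu>\<close> holds, for \<open>r < N\<close>, the weight of the pair \<open>r < c\<close> minus one (so
  that zeroed memory means that all weights are one), and, for \<open>r = N + j\<close>, the value of \<open>g\<^sub>j\<close> at \<open>c\<close>.\<close>

definition weight :: "nat \<Rightarrow> (nat \<Rightarrow> nat) \<Rightarrow> nat \<Rightarrow> nat \<Rightarrow> nat" where
  "weight N \<mu> a b = Suc (\<mu> (a * N + b))"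

definition row :: "nat \<Rightarrow> (nat \<Rightarrow> nat) \<Rightarrow> nat \<Rightarrow> nat \<Rightarrow> nat" where
  "row N \<mu> j a = \<mu> ((N + j) * N + a)"

text \<open>What the total weight gains if symbol \<open>b\<close> receives the value
  \<open>v\<close> in row \<open>j\<close>: the pairs that newly agree are doubled.\<close>

definition cost :: "nat \<Rightarrow> (nat \<Rightarrow> nat) \<Rightarrow> nat \<Rightarrow> nat \<Rightarrow> nat \<Rightarrow> nat" where
  "cost N \<mu> j b v = (\<Sum>a<b. if row N \<mu> j a = v then weight N \<mu> a b else 0)"

definition total :: "nat \<Rightarrow> (nat \<Rightarrow> nat) \<Rightarrow> nat \<Rightarrow> nat" where
  "total N \<mu> c = (\<Sum>b<c. \<Sum>a<b. weight N \<mu> a b)"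

text \<open>The memory after \<open>c\<close> passes of the reweighting loop. Cells store the weight
  minus one, so doubling a weight turns \<open>\<mu> x\<close> into
  \<open>2 * \<mu> x + 1\<close>.\<close>

definition reweight :: "nat \<Rightarrow> nat \<Rightarrow> nat \<Rightarrow> nat \<Rightarrow> nat \<Rightarrow> (nat \<Rightarrow> nat) \<Rightarrow> nat \<Rightarrow> nat" where
  "reweight N j b v c \<mu> x = (if \<exists>a<c. x = a * N + b \<and> row N \<mu> j a = v then 2 * \<mu> x + 1 else \<mu> x)"

text \<open>The situation inside row \<open>j\<close> once the symbols below \<open>b\<close> have
  their values; \<open>\<mu>0\<close> is the memory at the start of the row. Columns from
  \<open>b\<close> on keep their old weights. The last conjunct, a growth factor of at most
  \<open>1 + 1 / q\<close> on the finished columns, is written without division.\<close>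

definition row_inv :: "nat \<Rightarrow> nat \<Rightarrow> (nat \<Rightarrow> nat) \<Rightarrow> nat \<Rightarrow> nat \<Rightarrow> (nat \<Rightarrow> nat) \<Rightarrow> bool" where
  "row_inv N q \<mu>0 j b \<mu> \<longleftrightarrow>
     (\<forall>i<j. \<forall>a<N. row N \<mu> i a = row N \<mu>0 i a) \<and>
     (\<forall>a<b. row N \<mu> j a < q) \<and>
     (\<forall>c<N. \<forall>a<c. weight N \<mu> a c =
        (if c < b \<and> row N \<mu> j a = row N \<mu> j c then 2 * weight N \<mu>0 a c else weight N \<mu>0 a c)) \<and>
     q * total N \<mu> b \<le> Suc q * total N \<mu>0 b"

text \<open>The situation after \<open>j\<close> complete rows. In the last conjunct
  \<open>N ^ 2\<close> bounds the initial total, where every pair has weight one.\<close>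

definition code_inv :: "nat \<Rightarrow> nat \<Rightarrow> nat \<Rightarrow> (nat \<Rightarrow> nat) \<Rightarrow> bool" where
  "code_inv N q j \<mu> \<longleftrightarrow>
     (\<forall>i<j. \<forall>a<N. row N \<mu> i a < q) \<and>
     (\<forall>b<N. \<forall>a<b. weight N \<mu> a b = 2 ^ card {i. i < j \<and> row N \<mu> i a = row N \<mu> i b}) \<and>
     q ^ j * total N \<mu> N \<le> Suc q ^ j * N ^ 2"

lemma cell_eq_iff:
  fixes a b :: nat
  assumes "b < N" "b' < N"
  shows "a * N + b = a' * N + b' \<longleftrightarrow> a = a' \<and> b = b'"
proof
  assume "a * N + b = a' * N + b'"
  then have "(a * N + b) div N = (a' * N + b') div N" "(a * N + b) mod N = (a' * N + b') mod N"
    by simp_all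
  then show "a = a' \<and> b = b'"
    using assms by auto
qed simp

text \<open>The costs of the \<open>q\<close> values split the weight of column \<open>b\<close>
  according to the value at \<open>a\<close>, and the least of them is at most their
  average.\<close>

lemma min_cost_le_average:
  assumes "\<forall>a<b. row N \<mu> j a < q" "\<forall>u<q. cost N \<mu> j b v \<le> cost N \<mu> j b u"
  shows "q * cost N \<mu> j b v \<le> (\<Sum>a<b. weight N \<mu> a b)"
proof -
  have "q * cost N \<mu> j b v \<le> (\<Sum>u<q. cost N \<mu> j b u)"
    using sum_mono[of "{..<q}" "\<lambda>_. cost N \<mu> j b v"] assms(2) by simp
  also have "\<dots> = (\<Sum>a<b. \<Sum>u<q. if row N \<mu> j a = u then weight N \<mu> a b else 0)"
    unfolding cost_def by (rule sum.swap)
  also have "\<dots> = (\<Sum>a<b. weight N \<mu> a b)"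
    using assms(1) by (intro sum.cong) auto
  finally show ?thesis .
qed

text \<open>Storing \<open>v\<close> leaves the weights alone, and reweighting then adds exactly
  \<open>cost N \<mu> j b v\<close> to column \<open>b\<close>. By minimality this is at most a
  fraction \<open>1 / q\<close> of the column, whose weights are still those of
  \<open>\<mu>0\<close>.\<close>

lemma row_inv_step:
  assumes inv: "row_inv N q \<mu>0 j b \<mu>" and b: "b < N" and v: "v < q"
    and min: "\<forall>u<q. cost N \<mu> j b v \<le> cost N \<mu> j b u"
  defines "\<mu>1 \<equiv> \<mu>((N + j) * N + b := v)"
  shows "row_inv N q \<mu>0 j (Suc b) (reweight N j b v b \<mu>1)"
proof -
  let ?\<mu> = "reweight N j b v b \<mu>1"
  note cell = cell_eq_iff[where N = N]
  have row1: "row N \<mu>1 i a = (if i = j \<and> a = b then v else row N \<mu> i a)" if "a < N" for i a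
    using cell[OF that b, of "N + i" "N + j"] by (auto simp: row_def \<mu>1_def)
  have row2: "row N ?\<mu> i a = (if i = j \<and> a = b then v else row N \<mu> i a)" if "a < N" for i a
  proof -
    have "a' * N + b \<noteq> (N + i) * N + a" if "a' < b" for a'
      using cell[OF b \<open>a < N\<close>, of a' "N + i"] that b by auto
    then have "row N ?\<mu> i a = row N \<mu>1 i a"
      by (auto simp: row_def[of N ?\<mu>] row_def[of N \<mu>1 i a] reweight_def eq_commute)
    then show ?thesis using row1[OF that] by simp
  qed
  \<comment> \<open>Value rows start at row \<open>N\<close> of the memory, while the weights occupy
    rows below \<open>N\<close>.\<close>
  have w1: "weight N \<mu>1 a c = weight N \<mu> a c" if "a < c" "c < N" for a c
    using cell[OF that(2) b, of a "N + j"] that by (auto simp: weight_def \<mu>1_def)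
  have w2: "weight N ?\<mu> a c =
      (if c = b \<and> row N \<mu> j a = v then 2 * weight N \<mu> a c else weight N \<mu> a c)"
    if "a < c" "c < N" for a c
  proof -
    have "(\<exists>a'<b. a * N + c = a' * N + b \<and> row N \<mu>1 j a' = v) \<longleftrightarrow> c = b \<and> row N \<mu> j a = v"
      using cell[OF that(2) b] that b row1 by auto
    then have "weight N ?\<mu> a c =
        (if c = b \<and> row N \<mu> j a = v then 2 * weight N \<mu>1 a c else weight N \<mu>1 a c)"
      by (simp add: weight_def reweight_def)
    then show ?thesis by (simp only: w1[OF that])
  qed
  have w0: "weight N \<mu> a b = weight N \<mu>0 a b" if "a < b" for a
    using inv that b by (simp add: row_inv_def)
  have "(\<Sum>a<b. weight N ?\<mu> a b)
      = (\<Sum>a<b. weight N \<mu> a b + (if row N \<mu> j a = v then weight N \<mu> a b else 0))"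
    using b by (intro sum.cong) (auto simp: w2)
  also have "\<dots> = (\<Sum>a<b. weight N \<mu> a b) + cost N \<mu> j b v"
    by (simp add: sum.distrib cost_def)
  finally have "q * (\<Sum>a<b. weight N ?\<mu> a b) \<le> Suc q * (\<Sum>a<b. weight N \<mu> a b)"
    using min_cost_le_average[OF _ min] inv by (simp add: row_inv_def algebra_simps)
  also have "(\<Sum>a<b. weight N \<mu> a b) = (\<Sum>a<b. weight N \<mu>0 a b)"
    by (intro sum.cong) (auto simp: w0)
  finally have column: "q * (\<Sum>a<b. weight N ?\<mu> a b) \<le> Suc q * (\<Sum>a<b. weight N \<mu>0 a b)" .
  have "total N ?\<mu> b = total N \<mu> b"
    unfolding total_def using b by (intro sum.cong) (auto simp: w2)
  then have "q * total N ?\<mu> (Suc b) \<le> Suc q * total N \<mu>0 (Suc b)"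
    using column inv by (simp add: row_inv_def total_def distrib_left)
  then show ?thesis
    using inv b v unfolding row_inv_def by (auto simp: row2 w2 less_Suc_eq)
qed

text \<open>The pairs doubled during a finished row are exactly those that agree in it, so the
  exponent gains the index \<open>j\<close>, and the total gains one more factor of at most
  \<open>(q + 1) / q\<close>.\<close>

lemma code_inv_step:
  assumes inv: "code_inv N q j \<mu>0" and row: "row_inv N q \<mu>0 j N \<mu>"
  shows "code_inv N q (Suc j) \<mu>"
proof -
  have old: "row N \<mu> i a = row N \<mu>0 i a" if "i < j" "a < N" for i a
    using row that by (simp add: row_inv_def)
  have "weight N \<mu> a b = 2 ^ card {i. i < Suc j \<and> row N \<mu> i a = row N \<mu> i b}"
    if "a < b" "b < N" for a b
  proof -
    have "{i. i < Suc j \<and> row N \<mu> i a = row N \<mu> i b} =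
        (if row N \<mu> j a = row N \<mu> j b then insert j else id) {i. i < j \<and> row N \<mu>0 i a = row N \<mu>0 i b}"
      using that by (auto simp: less_Suc_eq old)
    moreover have "weight N \<mu>0 a b = 2 ^ card {i. i < j \<and> row N \<mu>0 i a = row N \<mu>0 i b}"
      using inv that by (simp add: code_inv_def)
    ultimately show ?thesis
      using row that by (simp add: row_inv_def)
  qed
  moreover have "q ^ Suc j * total N \<mu> N \<le> Suc q ^ Suc j * N ^ 2"
  proof -
    have "q ^ Suc j * total N \<mu> N = q ^ j * (q * total N \<mu> N)"
      by simp
    also have "\<dots> \<le> q ^ j * (Suc q * total N \<mu>0 N)"
      using row unfolding row_inv_def by (intro mult_le_mono2) blast
    also have "\<dots> = Suc q * (q ^ j * total N \<mu>0 N)"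
      by (simp add: algebra_simps)
    also have "\<dots> \<le> Suc q * (Suc q ^ j * N ^ 2)"
      using inv unfolding code_inv_def by (intro mult_le_mono2) blast
    finally show ?thesis by (simp add: algebra_simps)
  qed
  ultimately show ?thesis
    using inv row old unfolding code_inv_def by (auto simp: row_inv_def less_Suc_eq)
qed

lemma code_inv_0: "code_inv N q 0 (\<lambda>_. 0)"
proof -
  have "total N (\<lambda>_. 0) N = (\<Sum>b<N. b)"
    by (simp add: total_def weight_def)
  also have "\<dots> \<le> (\<Sum>b<N. N)"
    by (intro sum_mono) simp
  finally show ?thesis
    by (simp add: code_inv_def weight_def power2_eq_square)
qed

lemma row_inv_0: "row_inv N q \<mu> j 0 \<mu>"
  by (simp add: row_inv_def total_def)

text \<open>\<open>(1 + 1 / q) ^ q \<le> 3\<close> and \<open>3 ^ 5 \<le> 2 ^ 8\<close> give \<open>N\<^sup>2 (1 + 1 / q) ^ (5 q l) \<le> 2 ^ (2 l + 8 l)\<close>.\<close>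

lemma code_inv_total_le:
  assumes inv: "code_inv N q j \<mu>" and j: "j \<le> 5 * q * l" and N: "N \<le> 2 ^ l" and q: "0 < q"
  shows "total N \<mu> N \<le> 2 ^ (10 * l)"
proof -
  have "real q ^ j * real (total N \<mu> N) \<le> real (Suc q) ^ j * real N ^ 2"
    using inv unfolding code_inv_def by (metis of_nat_le_iff of_nat_mult of_nat_power)
  then have "real (total N \<mu> N) \<le> (real (Suc q) / real q) ^ j * real N ^ 2"
    using q by (simp add: power_divide field_simps)
  also have "\<dots> \<le> (real (Suc q) / real q) ^ (5 * q * l) * real N ^ 2"
    using q j by (intro mult_right_mono power_increasing) (auto simp: field_simps)
  also have "real (Suc q) / real q = 1 + 1 / real q"
    using q by (simp add: field_simps)
  also have "(1 + 1 / real q) ^ (5 * q * l) = ((1 + 1 / real q) ^ q) ^ (5 * l)"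
    by (simp flip: power_mult add: mult_ac)
  also have "\<dots> * real N ^ 2 \<le> 3 ^ (5 * l) * (2 ^ l) ^ 2"
  proof (intro mult_mono power_mono)
    have "(1 + 1 / real q) ^ q \<le> exp (1 / real q) ^ q"
      by (intro power_mono exp_ge_add_one_self) simp
    also have "\<dots> = exp 1"
      using q by (simp flip: exp_of_nat_mult)
    finally show "(1 + 1 / real q) ^ q \<le> 3"
      using exp_le by linarith
    show "real N \<le> 2 ^ l"
      using N by (metis of_nat_le_iff of_nat_numeral of_nat_power)
  qed auto
  also have "(3::real) ^ (5 * l) * (2 ^ l) ^ 2 = 243 ^ l * 4 ^ l"
    by (simp add: power_mult power_mult_distrib power2_eq_square flip: power_mult_distrib)
  also have "\<dots> \<le> 256 ^ l * 4 ^ l"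
    by (intro mult_right_mono power_mono) auto
  also have "\<dots> = real (2 ^ (10 * l))"
    by (simp add: power_mult flip: power_mult_distrib)
  finally show ?thesis
    by (simp only: of_nat_le_iff)
qed

lemma weight_le_total:
  assumes "a < b" "b < c"
  shows "weight N \<mu> a b \<le> total N \<mu> c"
proof -
  have "weight N \<mu> a b \<le> (\<Sum>a<b. weight N \<mu> a b)"
    using assms by (intro member_le_sum) auto
  also have "\<dots> \<le> total N \<mu> c"
    unfolding total_def using assms by (intro member_le_sum[where f = "\<lambda>b. \<Sum>a<b. weight N \<mu> a b"]) auto
  finally show ?thesis .
qed

text \<open>A single weight is at most the total, hence at most \<open>2 ^ (10 * l)\<close>, and it
  equals 2 to the number of agreements. Out of \<open>5 * q * l\<close> rows this is a fraction of
  \<open>2 / q\<close>.\<close>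

lemma code_inv_agreements:
  assumes inv: "code_inv N q (5 * q * l) \<mu>" and N: "N \<le> 2 ^ l" and q: "0 < q"
    and ab: "a < N" "b < N" "a \<noteq> b"
  shows "card {i. i < 5 * q * l \<and> row N \<mu> i a = row N \<mu> i b} \<le> 10 * l"
  using ab
\<comment> \<open>Weights are kept only for pairs in increasing order; agreement is
  symmetric.\<close>
proof (induction a b rule: linorder_wlog)
  case (le a b)
  then have "weight N \<mu> a b \<le> 2 ^ (10 * l)"
    using weight_le_total[of a b N N \<mu>] code_inv_total_le[OF inv _ N q] by force
  then show ?case
    using inv le by (simp add: code_inv_def)
qed (simp add: eq_commute)

subsection \<open>The machine code of the greedy choice\<close>

text \<open>Registers: 0 to 8 hold \<open>n\<close>, \<open>k\<close>, \<open>1\<close>, \<open>q\<close>, \<open>m\<close>, \<open>N\<close>, \<open>L\<close>, \<open>l\<close> (the logarithm of \<open>N\<close>) and \<open>0\<close>; 10 the current row \<open>j\<close>,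
  11 the current symbol \<open>b\<close>, 12 a candidate value for \<open>g\<^sub>j b\<close>, 13 the symbols \<open>a < b\<close>, 14 the cost of the
  candidate, 15 and 16 the least cost and the value attaining it, 19 the address of row \<open>j\<close>.\<close>

definition sum_prog :: com where
  "sum_prog = Const 14 0 ;; Const 13 0 ;; While (Less 13 11) (
     Arith Add 17 19 13 ;; Load 18 17 ;;
     If (Less 18 12) Skip (If (Less 12 18) Skip (
       Arith Mul 17 13 5 ;; Arith Add 17 17 11 ;; Load 18 17 ;;
       Arith Add 14 14 18 ;; Arith Add 14 14 2)) ;;
     Arith Add 13 13 2)"

text \<open>Registers 8 and 2 hold 0 and 1, so adding them copies and increments. The test
  \<open>Less 8 12\<close> lets the first candidate win unconditionally, since registers 15 and 16
  may still hold values left from the previous symbol.\<close>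

definition select_prog :: com where
  "select_prog = Const 12 0 ;; While (Less 12 3) (
     sum_prog ;;
     If (Less 8 12)
       (If (Less 14 15) (Arith Add 15 14 8 ;; Arith Add 16 12 8) Skip)
       (Arith Add 15 14 8 ;; Arith Add 16 12 8) ;;
     Arith Add 12 12 2)"

text \<open>Two opposite \<open>Less\<close> tests stand for equality; the innermost branch replaces
  a cell by twice its content plus one.\<close>

definition reweight_prog :: com where
  "reweight_prog = Const 13 0 ;; While (Less 13 11) (
     Arith Add 17 19 13 ;; Load 18 17 ;;
     If (Less 18 16) Skip (If (Less 16 18) Skip (
       Arith Mul 17 13 5 ;; Arith Add 17 17 11 ;; Load 18 17 ;;
       Arith Add 18 18 18 ;; Arith Add 18 18 2 ;; Store 18 17)) ;;
     Arith Add 13 13 2)"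

definition row_prog :: com where
  "row_prog = Arith Add 19 5 10 ;; Arith Mul 19 19 5 ;; Const 11 0 ;; While (Less 11 5) (
     select_prog ;; Arith Add 17 19 11 ;; Store 16 17 ;; reweight_prog ;; Arith Add 11 11 2)"

definition code_prog :: com where
  "code_prog = Const 10 0 ;; While (Less 10 6) (row_prog ;; Arith Add 10 10 2)"

definition frame :: "reg set \<Rightarrow> state \<Rightarrow> state \<Rightarrow> bool" where
  "frame X s s' \<longleftrightarrow> (\<forall>r. r \<notin> X \<longrightarrow> regs s' r = regs s r)"

text \<open>The memory consists of \<open>N + L\<close> rows of \<open>N\<close> cells,
  \<open>N\<close> rows for weights and \<open>L\<close> for values; \<open>cells\<close> makes
  every address fit into a word.\<close>

locale greedy =
  fixes \<delta> :: real and M N q L :: nat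
  assumes cells: "(N + L) * N \<le> M" and q: "0 < q" "q \<le> M" and N: "0 < N" and L: "0 < L"
begin

definition env :: "state \<Rightarrow> bool" where
  "env s \<longleftrightarrow> regs s 2 = 1 \<and> regs s 3 = q \<and> regs s 5 = N \<and> regs s 6 = L \<and> regs s 8 = 0"

lemma row_cell_less: "j < L \<Longrightarrow> a < N \<Longrightarrow> (N + j) * N + a < M"
proof -
  assume "j < L" "a < N"
  then have "(N + j) * N + a < (N + j) * N + N" by simp
  also have "\<dots> = (N + Suc j) * N" by simp
  also have "\<dots> \<le> (N + L) * N" using \<open>j < L\<close> by (intro mult_le_mono1) simp
  finally show ?thesis using cells by simp
qed

lemma weight_cell_less: "a < N \<Longrightarrow> b < N \<Longrightarrow> a * N + b < M"
proof -
  assume "a < N" "b < N"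
  then have "a * N + b < Suc a * N" by simp
  also have "\<dots> \<le> (N + L) * N" using \<open>a < N\<close> by (intro mult_le_mono1) simp
  finally show ?thesis using cells by simp
qed

lemma N_less_M: "N < M" and L_le_M: "L \<le> M"
proof -
  have "N + L \<le> (N + L) * N"
    using N by simp
  then have "N + L \<le> M"
    using cells by (rule le_trans)
  then show "N < M" "L \<le> M"
    using L by auto
qed

text \<open>Every partial sum is at most the weight of column \<open>b\<close>, which
  \<open>bound\<close> keeps within a word. The time is stated with \<open>N\<close> in place of
  \<open>b\<close> to be uniform in the symbol.\<close>

lemma wp_sum_prog:
  assumes env: "env s" and regs: "regs s 11 = b" "regs s 12 = v" "regs s 19 = (N + j) * N"
    and b: "b < N" and j: "j < L"
    and bound: "(\<Sum>a<b. weight N (mem s) a b) \<le> M"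
    and post: "\<And>s' t'. mem s' = mem s \<Longrightarrow> outp s' = outp s \<Longrightarrow> frame {13,14,17,18} s s' \<Longrightarrow>
      regs s' 14 = cost N (mem s) j b v \<Longrightarrow> t' \<le> t + 11 * N + 3 \<Longrightarrow> Q s' t'"
  shows "wp \<delta> M sum_prog Q s t"
proof -
  define part where "part c = (\<Sum>a<c. if row N (mem s) j a = v then weight N (mem s) a b else 0)" for c
  have part_le: "part c \<le> M" if "c \<le> b" for c
  proof -
    have "part c \<le> (\<Sum>a<c. weight N (mem s) a b)"
      unfolding part_def by (intro sum_mono) simp
    also have "\<dots> \<le> (\<Sum>a<b. weight N (mem s) a b)"
      using that by (intro sum_mono2) auto
    finally show ?thesis using bound by simp
  qed
  have part_Suc: "part (Suc c) = part c + (if row N (mem s) j c = v then weight N (mem s) c b else 0)" for c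
    by (simp add: part_def)
  let ?I = "\<lambda>c s'. mem s' = mem s \<and> outp s' = outp s \<and> frame {13,14,17,18} s s' \<and>
    regs s' 13 = c \<and> regs s' 14 = part c"
  show ?thesis
    unfolding sum_prog_def
  proof (simp, rule wp_While[where I = ?I and e = b and c = 10])
    fix c s' t assume I: "?I c s'" and c: "c < b"
    have "Suc (mem s (c * N + b) + part c) \<le> M" if "mem s ((N + j) * N + c) = v"
      using part_Suc[of c] part_le[of "Suc c"] c that by (simp add: weight_def row_def)
    then show "wp \<delta> M (Arith Add 17 19 13 ;; Load 18 17 ;;
       If (Less 18 12) Skip (If (Less 12 18) Skip (
         Arith Mul 17 13 5 ;; Arith Add 17 17 11 ;; Load 18 17 ;;
         Arith Add 14 14 18 ;; Arith Add 14 14 2)) ;;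
       Arith Add 13 13 2) (\<lambda>s' t'. ?I (Suc c) s' \<and> t' \<le> t + 10) s' t"
      using I env regs b c j row_cell_less[of j c] weight_cell_less[of c b] N_less_M part_Suc[of c]
      by (auto simp: frame_def env_def weight_def row_def add.commute)
  next
    fix s' t' assume I: "?I b s'" and t: "t' \<le> Suc (Suc t) + b * Suc 10 + 1"
    show "Q s' t'"
      using I t b by (intro post) (auto simp: part_def cost_def)
  qed (use regs in \<open>auto simp: frame_def part_def\<close>)
qed

lemma wp_select_prog:
  assumes env: "env s" and regs: "regs s 11 = b" "regs s 19 = (N + j) * N"
    and b: "b < N" and j: "j < L"
    and bound: "(\<Sum>a<b. weight N (mem s) a b) \<le> M"
    and post: "\<And>s' t' v. mem s' = mem s \<Longrightarrow> outp s' = outp s \<Longrightarrow> frame {12..18} s s' \<Longrightarrow>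
      regs s' 16 = v \<Longrightarrow> v < q \<Longrightarrow> \<forall>u<q. cost N (mem s) j b v \<le> cost N (mem s) j b u \<Longrightarrow>
      t' \<le> t + q * (11 * N + 9) + 2 \<Longrightarrow> Q s' t'"
  shows "wp \<delta> M select_prog Q s t"
proof -
  let ?cost = "cost N (mem s) j b"
  \<comment> \<open>Before the first candidate registers 15 and 16 are arbitrary, hence the guard
    \<open>0 < v\<close>.\<close>
  let ?I = "\<lambda>v s'. mem s' = mem s \<and> outp s' = outp s \<and> frame {12..18} s s' \<and> regs s' 12 = v \<and>
    (0 < v \<longrightarrow> regs s' 16 < v \<and> regs s' 15 = ?cost (regs s' 16) \<and>
      (\<forall>u<v. ?cost (regs s' 16) \<le> ?cost u))"
  have cost_le: "?cost v \<le> M" for v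
  proof -
    have "?cost v \<le> (\<Sum>a<b. weight N (mem s) a b)"
      unfolding cost_def by (intro sum_mono) simp
    then show ?thesis using bound by simp
  qed
  show ?thesis
    unfolding select_prog_def
  proof (simp, rule wp_While[where I = ?I and e = q and c = "11 * N + 8"])
    fix v s' t assume I: "?I v s'" and v: "v < q"
    show "wp \<delta> M (sum_prog ;;
       If (Less 8 12)
         (If (Less 14 15) (Arith Add 15 14 8 ;; Arith Add 16 12 8) Skip)
         (Arith Add 15 14 8 ;; Arith Add 16 12 8) ;;
       Arith Add 12 12 2) (\<lambda>s' t'. ?I (Suc v) s' \<and> t' \<le> t + (11 * N + 8)) s' t"
    proof (subst wp_Seq, rule wp_sum_prog[OF _ _ _ _ b j])
      fix s'' t'
      assume "mem s'' = mem s'" "outp s'' = outp s'" "frame {13,14,17,18} s' s''"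
        "regs s'' 14 = cost N (mem s') j b v" "t' \<le> t + 11 * N + 3"
      then show "wp \<delta> M (If (Less 8 12)
         (If (Less 14 15) (Arith Add 15 14 8 ;; Arith Add 16 12 8) Skip)
         (Arith Add 15 14 8 ;; Arith Add 16 12 8) ;;
         Arith Add 12 12 2) (\<lambda>s' t'. ?I (Suc v) s' \<and> t' \<le> t + (11 * N + 8)) s'' t'"
        using I env v q cost_le[of v]
        by (auto simp: frame_def env_def less_Suc_eq intro: less_imp_le order_trans)
    qed (use I env regs bound in \<open>auto simp: frame_def env_def\<close>)
  next
    fix s' t' assume I: "?I q s'" and t: "t' \<le> Suc t + q * Suc (11 * N + 8) + 1"
    show "Q s' t'"
      using I t q by (intro post[of s' "regs s' 16"]) (auto simp: add.commute)
  qed (use env in \<open>auto simp: frame_def env_def\<close>)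
qed

lemma wp_reweight_prog:
  assumes env: "env s" and regs: "regs s 11 = b" "regs s 16 = v" "regs s 19 = (N + j) * N"
    and b: "b < N" and j: "j < L"
    and bound: "\<And>a. a < b \<Longrightarrow> 2 * weight N (mem s) a b \<le> M"
    and post: "\<And>s' t'. mem s' = reweight N j b v b (mem s) \<Longrightarrow> outp s' = outp s \<Longrightarrow>
      frame {13,17,18} s s' \<Longrightarrow> t' \<le> t + 12 * N + 2 \<Longrightarrow> Q s' t'"
  shows "wp \<delta> M reweight_prog Q s t"
proof -
  note cell = cell_eq_iff[where N = N]
  let ?I = "\<lambda>c s'. mem s' = reweight N j b v c (mem s) \<and> outp s' = outp s \<and>
    frame {13,17,18} s s' \<and> regs s' 13 = c"
  show ?thesis
    unfolding reweight_prog_def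
  proof (simp, rule wp_While[where I = ?I and e = b and c = 11])
    fix c s' t assume I: "?I c s'" and c: "c < b"
    \<comment> \<open>Earlier passes wrote only to column \<open>b\<close> in rows below
      \<open>c\<close>: neither the value read at column \<open>c\<close> nor the weight in row
      \<open>c\<close> has changed.\<close>
    have "(N + j) * N + c \<noteq> a * N + b" if "a < c" for a
      using cell[of c b "N + j" a] that b c by auto
    then have old_row: "mem s' ((N + j) * N + c) = mem s ((N + j) * N + c)"
      using I by (auto simp: reweight_def)
    have "c * N + b \<noteq> a * N + b" if "a < c" for a
      using cell[of b b c a] that b by auto
    then have old_weight: "mem s' (c * N + b) = mem s (c * N + b)"
      using I by (auto simp: reweight_def)
    have "reweight N j b v (Suc c) (mem s) =
      (if row N (mem s) j c = v
       then (mem s')(c * N + b := Suc (mem s' (c * N + b) + mem s' (c * N + b))) else mem s')"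
      using I old_weight by (auto simp: reweight_def fun_eq_iff less_Suc_eq)
    then show "wp \<delta> M (Arith Add 17 19 13 ;; Load 18 17 ;;
       If (Less 18 16) Skip (If (Less 16 18) Skip (
         Arith Mul 17 13 5 ;; Arith Add 17 17 11 ;; Load 18 17 ;;
         Arith Add 18 18 18 ;; Arith Add 18 18 2 ;; Store 18 17)) ;;
       Arith Add 13 13 2) (\<lambda>s' t'. ?I (Suc c) s' \<and> t' \<le> t + 11) s' t"
      using I env regs b c j row_cell_less[of j c] weight_cell_less[of c b] N_less_M bound[OF c]
        old_row old_weight
      by (auto simp: frame_def env_def weight_def row_def)
  next
    fix s' t' assume I: "?I b s'" and t: "t' \<le> Suc t + b * Suc 11 + 1"
    show "Q s' t'"
      using I t b by (intro post) auto
  qed (use regs in \<open>auto simp: frame_def reweight_def fun_eq_iff\<close>)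
qed

lemma row_inv_column:
  assumes "row_inv N q \<mu>0 j b \<mu>" "b < N" "a < b"
  shows "weight N \<mu> a b = weight N \<mu>0 a b"
  using assms by (simp add: row_inv_def)

text \<open>Twice the initial total bounds both the column sums formed by the selection and the
  doubled weights, because each column is processed while it still has its initial weights.\<close>

lemma wp_row_prog:
  assumes env: "env s" and regs: "regs s 10 = j" and j: "j < L"
    and inv: "code_inv N q j (mem s)" and bound: "2 * total N (mem s) N \<le> M"
    and post: "\<And>s' t'. code_inv N q (Suc j) (mem s') \<Longrightarrow> outp s' = outp s \<Longrightarrow> frame {11..19} s s' \<Longrightarrow>
      t' \<le> t + N * (q * (11 * N + 9) + 12 * N + 8) + 4 \<Longrightarrow> Q s' t'"
  shows "wp \<delta> M row_prog Q s t"
proof -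
  let ?I = "\<lambda>b s'. row_inv N q (mem s) j b (mem s') \<and> outp s' = outp s \<and> frame {11..19} s s' \<and>
    regs s' 11 = b \<and> regs s' 19 = (N + j) * N"
  have "(N + j) * N \<le> M"
    using row_cell_less[OF j N] by simp
  moreover have "N + j \<le> (N + j) * N"
    using N by simp
  ultimately have le: "N + j \<le> M" "(N + j) * N \<le> M"
    by linarith+
  show ?thesis
    unfolding row_prog_def
  proof (simp, intro conjI, goal_cases)
    case 3
    show ?case
    proof (rule wp_While[where I = ?I and e = N and c = "q * (11 * N + 9) + 12 * N + 7"])
      fix b s' t assume I: "?I b s'" and b: "b < N"
      then have row: "row_inv N q (mem s) j b (mem s')"
        by simp
      have env': "env s'" "regs s' 11 = b" "regs s' 19 = (N + j) * N"
        using env I by (auto simp: env_def frame_def)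
      have "(\<Sum>a<b. weight N (mem s) a b) \<le> total N (mem s) N"
        unfolding total_def using b
        by (intro member_le_sum[where f = "\<lambda>b. \<Sum>a<b. weight N (mem s) a b"]) auto
      then have sum_le: "(\<Sum>a<b. weight N (mem s') a b) \<le> M"
        using bound row_inv_column[OF row b] by simp
      show "wp \<delta> M (select_prog ;; Arith Add 17 19 11 ;; Store 16 17 ;; reweight_prog ;;
          Arith Add 11 11 2) (\<lambda>s' t'. ?I (Suc b) s' \<and> t' \<le> t + (q * (11 * N + 9) + 12 * N + 7)) s' t"
      proof (subst wp_Seq, rule wp_select_prog[OF env' b j sum_le])
        fix s1 t1 v
        assume s1: "mem s1 = mem s'" "outp s1 = outp s'" "frame {12..18} s' s1" "regs s1 16 = v"
          and v: "v < q" "\<forall>u<q. cost N (mem s') j b v \<le> cost N (mem s') j b u"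
          and t1: "t1 \<le> t + q * (11 * N + 9) + 2"
        have env1: "env s1" "regs s1 11 = b" "regs s1 19 = (N + j) * N"
          using env' s1 by (auto simp: env_def frame_def)
        \<comment> \<open>The state between storing the value and reweighting; its memory is the
          \<open>\<mu>1\<close> of \<open>row_inv_step\<close>.\<close>
        let ?s2 = "s1\<lparr>regs := (regs s1)(17 := (N + j) * N + b), mem := (mem s1)((N + j) * N + b := v)\<rparr>"
        have "wp \<delta> M (reweight_prog ;; Arith Add 11 11 2)
          (\<lambda>s' t'. ?I (Suc b) s' \<and> t' \<le> t + (q * (11 * N + 9) + 12 * N + 7)) ?s2 (t1 + 2)"
        proof (subst wp_Seq, rule wp_reweight_prog[where b = b and v = v and j = j, OF _ _ _ _ b j])
          fix a assume a: "a < b"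
          have "(N + j) * N + b \<noteq> a * N + b"
            using a b by simp
          then have "weight N (mem ?s2) a b = weight N (mem s) a b"
            using row_inv_column[OF row b a] by (simp add: weight_def s1)
          then show "2 * weight N (mem ?s2) a b \<le> M"
            using weight_le_total[OF a b, of N "mem s"] bound by linarith
        next
          fix s3 t3
          assume s3: "mem s3 = reweight N j b v b (mem ?s2)" "outp s3 = outp ?s2"
            "frame {13,17,18} ?s2 s3" "t3 \<le> t1 + 2 + 12 * N + 2"
          have "row_inv N q (mem s) j (Suc b) (mem s3)"
            using row_inv_step[OF row b v] by (simp add: s3 s1)
          then show "wp \<delta> M (Arith Add 11 11 2)
            (\<lambda>s' t'. ?I (Suc b) s' \<and> t' \<le> t + (q * (11 * N + 9) + 12 * N + 7)) s3 t3"
            using s3 s1 env1 I t1 b N_less_M by (auto simp: env_def frame_def)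
        qed (use env1 s1 in \<open>auto simp: env_def\<close>)
        then show "wp \<delta> M (Arith Add 17 19 11 ;; Store 16 17 ;; reweight_prog ;; Arith Add 11 11 2)
          (\<lambda>s' t'. ?I (Suc b) s' \<and> t' \<le> t + (q * (11 * N + 9) + 12 * N + 7)) s1 t1"
          using env1 s1(4) row_cell_less[OF j b] by simp
      qed
    next
      fix s' t' assume I: "?I N s'"
        and t: "t' \<le> Suc (Suc (Suc t)) + N * Suc (q * (11 * N + 9) + 12 * N + 7) + 1"
      show "Q s' t'"
        using I t code_inv_step[OF inv] by (intro post) (auto simp: algebra_simps)
    qed (use env regs in \<open>auto simp: frame_def env_def row_inv_0\<close>)
  qed (use env regs le in \<open>auto simp: env_def\<close>)
qed

text \<open>\<open>bound\<close> is asked of every memory that satisfies the invariant;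
  \<open>code_inv_total_le\<close> supplies it once \<open>L\<close> and \<open>M\<close> are
  fixed.\<close>

lemma wp_code_prog:
  assumes env: "env s" and inv: "code_inv N q 0 (mem s)"
    and bound: "\<And>j \<mu>. j \<le> L \<Longrightarrow> code_inv N q j \<mu> \<Longrightarrow> 2 * total N \<mu> N \<le> M"
    and post: "\<And>s' t'. code_inv N q L (mem s') \<Longrightarrow> outp s' = outp s \<Longrightarrow> frame {10..19} s s' \<Longrightarrow>
      t' \<le> t + L * (N * (q * (11 * N + 9) + 12 * N + 8) + 6) + 2 \<Longrightarrow> Q s' t'"
  shows "wp \<delta> M code_prog Q s t"
proof -
  let ?I = "\<lambda>j s'. code_inv N q j (mem s') \<and> outp s' = outp s \<and> frame {10..19} s s' \<and> regs s' 10 = j"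
  show ?thesis
    unfolding code_prog_def
  proof (simp, rule wp_While[where I = ?I and e = L and c = "N * (q * (11 * N + 9) + 12 * N + 8) + 5"])
    fix j s' t assume I: "?I j s'" and j: "j < L"
    then have env': "env s'" and inv': "code_inv N q j (mem s')" and reg: "regs s' 10 = j"
      using env by (auto simp: env_def frame_def)
    show "wp \<delta> M (row_prog ;; Arith Add 10 10 2)
      (\<lambda>s' t'. ?I (Suc j) s' \<and> t' \<le> t + (N * (q * (11 * N + 9) + 12 * N + 8) + 5)) s' t"
    proof (subst wp_Seq, rule wp_row_prog[OF env' reg j inv' bound[OF _ inv']])
      fix s1 t1
      assume "code_inv N q (Suc j) (mem s1)" "outp s1 = outp s'" "frame {11..19} s' s1"
        "t1 \<le> t + N * (q * (11 * N + 9) + 12 * N + 8) + 4"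
      then show "wp \<delta> M (Arith Add 10 10 2)
        (\<lambda>s' t'. ?I (Suc j) s' \<and> t' \<le> t + (N * (q * (11 * N + 9) + 12 * N + 8) + 5)) s1 t1"
        using I env' j L_le_M by (auto simp: env_def frame_def)
    qed (use j in simp)
  next
    fix s' t' assume I: "?I L s'"
      and t: "t' \<le> Suc t + L * Suc (N * (q * (11 * N + 9) + 12 * N + 8) + 5) + 1"
    show "Q s' t'"
      using I t by (intro post) (auto simp: algebra_simps)
  qed (use env inv in \<open>auto simp: frame_def env_def\<close>)
qed

end

subsection \<open>Parameters and output\<close>

text \<open>\<open>q\<close> is found by counting upwards, as \<open>\<delta>\<close> can only be
  compared with ratios; register 9 is the exit flag. Then come the least \<open>m\<close> with
  \<open>n < m * m\<close> and the least \<open>l\<close> with \<open>N \<le> 2 ^ l\<close>.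
  Registers 3, 4, 7, 8, 9 and 23 rely on being zero initially.\<close>

definition params_prog :: com where
  "params_prog = Const 2 1 ;;
     Arith Mul 20 1 1 ;; Arith Add 20 20 20 ;;
     While (Less 9 2) (Arith Add 21 20 3 ;; If (Ratio_le 21 3) (Arith Add 9 2 8) (Arith Add 3 3 2)) ;;
     Arith Add 22 0 2 ;;
     While (Less 23 22) (Arith Add 4 4 2 ;; Arith Mul 23 4 4) ;;
     Arith Mul 5 3 4 ;; Const 24 1 ;;
     While (Less 24 5) (Arith Add 24 24 24 ;; Arith Add 7 7 2) ;;
     Const 25 5 ;; Arith Mul 6 25 3 ;; Arith Mul 6 6 7"

text \<open>Register 26 codes a slope (quotient by \<open>L\<close>) and a row (remainder). Register
  30 is incremented before use, so arguments run from 1 to \<open>n\<close>; the last increment of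
  register 31 shifts values below \<open>q\<close> into \<open>{1..q}\<close>.\<close>

definition output_prog :: com where
  "output_prog = Arith Mul 27 3 6 ;; Const 26 0 ;; While (Less 26 27) (
     Arith Div 28 26 6 ;; Arith Mod 29 26 6 ;; Arith Add 29 5 29 ;; Arith Mul 29 29 5 ;; Const 30 0 ;;
     While (Less 30 0) (
       Arith Add 30 30 2 ;; Arith Mod 31 30 4 ;; Arith Div 32 30 4 ;; Arith Mul 32 28 32 ;;
       Arith Add 31 31 32 ;; Arith Add 31 29 31 ;; Load 31 31 ;; Arith Add 31 31 2 ;; Output 31) ;;
     Arith Add 26 26 2)"

definition splitter_prog :: com where
  "splitter_prog = params_prog ;; code_prog ;; output_prog"

section \<open>Arithmetic of the parameters\<close>

locale splitter_params =
  fixes \<delta> :: real and n k q :: nat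
  assumes k: "1 \<le> k" "k \<le> n" and \<delta>: "1 < \<delta>" "\<delta> \<le> 2"
    and q_def: "q = nat \<lceil>2 * real k ^ 2 / (\<delta> - 1)\<rceil>"
begin

text \<open>The strict inequality gives \<open>x div m < m\<close> even for
  \<open>x = n\<close>.\<close>

definition m :: nat where "m = (LEAST m. n < m * m)"
definition N :: nat where "N = q * m"
definition l :: nat where "l = (LEAST l. N \<le> 2 ^ l)"
definition L :: nat where "L = 5 * q * l"

abbreviation M :: nat where "M \<equiv> (n + q) ^ 40"

lemma q_le_iff: "q \<le> v \<longleftrightarrow> 2 * real k ^ 2 / (\<delta> - 1) \<le> real v"
  unfolding q_def by (simp add: nat_le_iff ceiling_le_iff)

lemma q_ge: "2 * real k ^ 2 / (\<delta> - 1) \<le> real q"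
  using q_le_iff by blast

lemma two_k2_le_q: "2 * k ^ 2 \<le> q"
proof -
  have "2 * real k ^ 2 \<le> 2 * real k ^ 2 / (\<delta> - 1)"
    using \<delta> by (simp add: pos_le_divide_eq mult_left_le)
  then have "real (2 * k ^ 2) \<le> real q"
    using q_ge by simp
  then show ?thesis by (simp only: of_nat_le_iff)
qed

text \<open>Rounding up adds at most one, which \<open>k ^ 2 / (\<delta> - 1) \<ge> 1\<close>
  absorbs.\<close>

lemma q_le: "real q \<le> 3 * real k ^ 2 / (\<delta> - 1)"
proof -
  let ?x = "real k ^ 2 / (\<delta> - 1)"
  have "\<delta> - 1 \<le> real k ^ 2"
    using \<delta> k one_le_power[of "real k" 2] by linarith
  then have "1 \<le> ?x"
    using \<delta> by (simp add: pos_le_divide_eq)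
  moreover have "real q \<le> 2 * ?x + 1"
    unfolding q_def using \<open>1 \<le> ?x\<close> by (simp add: of_nat_nat)
  ultimately show ?thesis by simp
qed

lemma q_ge_2: "2 \<le> q"
proof -
  have "1 \<le> k ^ 2" using k by simp
  then show ?thesis using two_k2_le_q by linarith
qed

text \<open>Squaring is monotone, so the least \<open>m\<close> is a threshold; this matches the
  test of the search loop.\<close>

lemma less_m_iff: "v < m \<longleftrightarrow> v * v \<le> n"
proof -
  have ex: "n < m * m"
    unfolding m_def by (rule LeastI[of _ "Suc n"]) simp
  have "m \<le> v" if "n < v * v"
    unfolding m_def using that by (rule Least_le)
  moreover have "m * m \<le> v * v" if "m \<le> v"
    using that by (intro mult_le_mono)
  ultimately show ?thesis using ex by (meson leD leI le_trans not_less)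
qed

lemma m_ge_2: "2 \<le> m"
  using less_m_iff[of 1] k by simp

text \<open>Minimality gives \<open>(m - 1) * (m - 1) \<le> n\<close>. This keeps the table of
  \<open>N * N\<close> weights linear in \<open>n\<close>.\<close>

lemma m_square_le: "m * m \<le> 4 * n"
proof -
  have "m \<le> 2 * (m - 1)"
    using m_ge_2 by simp
  then have "m * m \<le> (2 * (m - 1)) * (2 * (m - 1))"
    by (intro mult_le_mono)
  also have "\<dots> = 4 * ((m - 1) * (m - 1))"
    by simp
  also have "(m - 1) * (m - 1) \<le> n"
    using less_m_iff[of "m - 1"] m_ge_2 by simp
  finally show ?thesis by simp
qed

lemma m_le: "m \<le> Suc n"
  using less_m_iff[of "Suc n"] by (simp add: not_less[symmetric])

lemma less_l_iff: "v < l \<longleftrightarrow> 2 ^ v < N"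
proof -
  have ex: "N \<le> 2 ^ l"
    unfolding l_def by (rule LeastI[of _ N]) (simp add: less_imp_le)
  have "l \<le> v" if "N \<le> 2 ^ v"
    unfolding l_def using that by (rule Least_le)
  moreover have "(2::nat) ^ l \<le> 2 ^ v" if "l \<le> v"
    using that by (intro power_increasing) auto
  ultimately show ?thesis using ex by (meson leD leI le_trans not_less)
qed

lemma N_ge_4: "4 \<le> N"
  unfolding N_def using mult_le_mono[OF q_ge_2 m_ge_2] by simp

lemma l_pos: "0 < l"
  using less_l_iff[of 0] N_ge_4 by simp

lemma N_le_power: "N \<le> 2 ^ l"
  using less_l_iff[of l] by simp

lemma power_l_less: "2 ^ l < 2 * N"
proof -
  have "2 ^ (l - 1) < N"
    using less_l_iff[of "l - 1"] l_pos by simp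
  then show ?thesis
    using l_pos by (cases l) auto
qed

lemma L_pos: "0 < L"
  using q_ge_2 l_pos by (simp add: L_def)

text \<open>Every quantity is bounded by a power of \<open>n + q\<close>, with
  \<open>3 \<le> n + q\<close> absorbing the constants. The largest is twice the bound on the total
  weight, at most the 31st power, so the exponent 40 is generous.\<close>

lemma word_bounds:
  shows "N \<le> M" "m * m \<le> M" "5 * q \<le> M" "L \<le> M" "q * L \<le> M" "(N + L) * N \<le> M" "2 * 2 ^ (10 * l) \<le> M"
    "2 ^ l \<le> M" "2 * k * k + q \<le> M" "n + q \<le> M" "5 \<le> M" "l \<le> M"
proof -
  let ?X = "n + q"
  have X: "3 \<le> ?X" using q_ge_2 k by linarith
  have mono: "?X ^ i \<le> ?X ^ j" if "i \<le> j" for i j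
    using that X by (intro power_increasing) auto
  have pw: "a * b \<le> ?X ^ c" if "a \<le> ?X ^ i" "b \<le> ?X ^ j" "c = i + j" for a b c i j
    unfolding that(3) power_add using that(1,2) by (rule mult_le_mono)
  have x1: "n \<le> ?X ^ 1" "q \<le> ?X ^ 1" "m \<le> ?X ^ 1" "2 \<le> ?X ^ 1" "k \<le> ?X ^ 1"
    using m_le q_ge_2 k by simp_all
  have five: "5 \<le> ?X ^ 2"
    using mult_le_mono[OF X X] by (simp add: power2_eq_square)
  have N: "N \<le> ?X ^ 2"
    using pw[OF x1(2,3), of 2] by (simp add: N_def)
  have "2 ^ l \<le> 2 * N"
    using power_l_less by simp
  also have "2 * N \<le> ?X ^ 3"
    using pw[OF x1(4) N, of 3] by simp
  finally have l2: "2 ^ l \<le> ?X ^ 3" .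
  have l: "l \<le> ?X ^ 3"
    using l2 less_exp[of l] by linarith
  have q5: "5 * q \<le> ?X ^ 3"
    using pw[OF five x1(2), of 3] by simp
  have L: "L \<le> ?X ^ 6"
    using pw[OF q5 l, of 6] by (simp add: L_def)
  have qL: "q * L \<le> ?X ^ 7"
    using pw[OF x1(2) L, of 7] by simp
  have "N \<le> ?X ^ 6"
    using N mono[of 2 6] by linarith
  then have "N + L \<le> 2 * ?X ^ 6"
    using L by linarith
  also have "\<dots> \<le> ?X ^ 7"
    using pw[OF x1(4), of "?X ^ 6" 6 7] by simp
  finally have NL: "(N + L) * N \<le> ?X ^ 9"
    using pw[OF _ N, of "N + L" 7 9] by simp
  have "(2::nat) ^ (10 * l) = (2 ^ l) ^ 10"
    by (simp add: mult.commute flip: power_mult)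
  also have "\<dots> \<le> (?X ^ 3) ^ 10"
    using l2 by (intro power_mono) auto
  also have "\<dots> = ?X ^ 30"
    by (simp flip: power_mult)
  finally have B: "2 * 2 ^ (10 * l) \<le> ?X ^ 31"
    using pw[OF x1(4), of _ 30 31] by simp
  have "k * k \<le> k ^ 2" by (simp add: power2_eq_square)
  then have "2 * k * k + q \<le> 2 * q"
    using two_k2_le_q by linarith
  also have "\<dots> \<le> ?X ^ 2"
    using pw[OF x1(4) x1(2), of 2] by simp
  finally have kq: "2 * k * k + q \<le> ?X ^ 2" .
  have mm: "m * m \<le> ?X ^ 2"
    using pw[OF x1(3) x1(3), of 2] by simp
  show "N \<le> M" using N mono[of 2 40] by linarith
  show "m * m \<le> M" using mm mono[of 2 40] by linarith
  show "5 * q \<le> M" using q5 mono[of 3 40] by linarith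
  show "L \<le> M" using L mono[of 6 40] by linarith
  show "q * L \<le> M" using qL mono[of 7 40] by linarith
  show "(N + L) * N \<le> M" using NL mono[of 9 40] by linarith
  show "2 * 2 ^ (10 * l) \<le> M" using B mono[of 31 40] by linarith
  show "2 ^ l \<le> M" using l2 mono[of 3 40] by linarith
  show "2 * k * k + q \<le> M" using kq mono[of 2 40] by linarith
  show "n + q \<le> M" using mono[of 1 40] by simp
  show "5 \<le> M" using five mono[of 2 40] by linarith
  show "l \<le> M" using l mono[of 3 40] by linarith
qed

sublocale greedy \<delta> M N q L
  using word_bounds q_ge_2 N_ge_4 L_pos by unfold_locales auto

text \<open>Clearing the denominator \<open>\<delta> - 1\<close> turns the definition of
  \<open>q\<close> into a test that the machine offers. At \<open>v = 0\<close> both sides are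
  false.\<close>

lemma ratio_test: "real (2 * k * k + v) \<le> \<delta> * real v \<longleftrightarrow> q \<le> v"
proof -
  have "q \<le> v \<longleftrightarrow> 2 * real k ^ 2 \<le> real v * (\<delta> - 1)"
    using \<delta> by (simp add: q_le_iff pos_divide_le_eq)
  then show ?thesis
    by (simp add: power2_eq_square algebra_simps)
qed

lemma wp_params_prog:
  assumes post: "\<And>s' t'. env s' \<Longrightarrow> regs s' 0 = n \<Longrightarrow> regs s' 4 = m \<Longrightarrow> mem s' = (\<lambda>_. 0) \<Longrightarrow>
    outp s' = [] \<Longrightarrow> t' \<le> 4 * q + 3 * m + 3 * l + 16 \<Longrightarrow> Q s' t'"
  shows "wp \<delta> M params_prog Q (init_state n k) 0"
proof -
  let ?base = "\<lambda>s. regs s 0 = n \<and> regs s 2 = 1 \<and> regs s 8 = 0 \<and> mem s = (\<lambda>_. 0) \<and> outp s = []"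
  \<comment> \<open>The search for \<open>q\<close> takes \<open>q + 1\<close> passes:
    \<open>q\<close> increments, and a last pass that only sets the flag.\<close>
  let ?I1 = "\<lambda>v s. ?base s \<and> regs s 4 = 0 \<and> regs s 7 = 0 \<and> regs s 23 = 0 \<and> regs s 20 = 2 * k * k \<and>
    regs s 3 = min v q \<and> regs s 9 = (if v \<le> q then 0 else 1)"
  let ?I2 = "\<lambda>v s. ?base s \<and> regs s 3 = q \<and> regs s 7 = 0 \<and> regs s 22 = Suc n \<and> regs s 4 = v \<and> regs s 23 = v * v"
  let ?I3 = "\<lambda>v s. ?base s \<and> regs s 3 = q \<and> regs s 4 = m \<and> regs s 5 = N \<and> regs s 7 = v \<and> regs s 24 = 2 ^ v"
  have k2: "k * k + k * k \<le> M" "k * k \<le> M"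
    using word_bounds(9) by simp_all
  note bounds = word_bounds q_ge_2
  show ?thesis
    unfolding params_prog_def
  proof (simp only: wp_Seq wp_simps, intro conjI, goal_cases)
    case 4
    show ?case
    proof (rule wp_While[where I = ?I1 and e = "Suc q" and c = 3], goal_cases)
      case 1
      then show ?case by (simp add: init_state_def)
    next
      case (3 v s t)
      have "2 * k * k + min v q \<le> M"
        using word_bounds(9) by linarith
      then show ?case
        using 3 ratio_test[of v] bounds by (auto simp: min_def)
    next
      case (4 s1 t1)
      note t1 = 4(2)
      from 4 show ?case
      proof (simp, intro conjI, goal_cases)
        case 2
        show ?case
        proof (rule wp_While[where I = ?I2 and e = m and c = 2], goal_cases)
          case (2 v s)
          then show ?case using less_m_iff[of v] by auto
        next
          case (3 v s t)
          have "Suc v * Suc v \<le> m * m"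
            using 3 by (intro mult_le_mono) auto
          moreover have "Suc v \<le> Suc v * Suc v"
            by simp
          ultimately show ?case
            using 3 bounds by auto
        next
          case (4 s2 t2)
          note t2 = 4(2)
          from 4 show ?case
          proof (simp add: N_def[symmetric], intro conjI, goal_cases)
            case 3
            show ?case
            proof (rule wp_While[where I = ?I3 and e = l and c = 2], goal_cases)
              case (2 v s)
              then show ?case using less_l_iff[of v] by auto
            next
              case (3 v s t)
              have "(2::nat) ^ Suc v \<le> 2 ^ l"
                using 3 by (intro power_increasing) auto
              then show ?case
                using 3 bounds by auto
            next
              case (4 s3 t3)
              note t3 = 4(2)
              from 4 show ?case
                using bounds t1 t2 t3 by (simp add: L_def[symmetric], intro post) (simp_all add: env_def)
            qed (use 3 in simp)
          qed (use bounds in auto)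
        qed (use 2 in simp)
      qed (use bounds in auto)
    qed (auto simp: init_state_def)
  qed (use bounds k2 in \<open>auto simp: init_state_def\<close>)
qed

section \<open>The composed functions and their output\<close>

definition symbol :: "nat \<Rightarrow> nat \<Rightarrow> nat" where
  "symbol i x = x mod m + i * (x div m)"

text \<open>The index \<open>f\<close> codes the pair of \<open>i = f div L\<close> and
  \<open>j = f mod L\<close>; \<open>Suc\<close> moves the values from below \<open>q\<close> into
  \<open>{1..q}\<close>.\<close>

definition splitter_fun :: "(nat \<Rightarrow> nat) \<Rightarrow> nat \<Rightarrow> nat \<Rightarrow> nat" where
  "splitter_fun \<mu> f = (\<lambda>x\<in>{1..n}. Suc (row N \<mu> (f mod L) (symbol (f div L) x)))"

lemma symbol_less:
  assumes "x \<le> n" "i < q"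
  shows "symbol i x < N"
proof -
  have "x < m * m"
    using assms(1) less_m_iff[of m] by simp
  then have "Suc (x div m) \<le> m"
    by (simp add: Suc_leI less_mult_imp_div_less)
  have "symbol i x < m + i * (x div m)"
    using m_ge_2 by (simp add: symbol_def)
  also have "\<dots> \<le> m + (q - 1) * m"
    using assms(2) \<open>Suc (x div m) \<le> m\<close> by (intro add_left_mono mult_le_mono) auto
  also have "\<dots> = N"
    unfolding N_def using q_ge_2 by (cases q) auto
  finally show ?thesis .
qed

text \<open>Subtracting the two equations leaves \<open>(i - i') * (x div m - y div m) = 0\<close>,
  over the integers to avoid truncated subtraction. Equal quotients then force equal
  remainders.\<close>

lemma symbol_inj:
  assumes "symbol i x = symbol i y" "symbol i' x = symbol i' y" "i \<noteq> i'"
  shows "x = y"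
proof -
  have "(int i - int i') * (int (x div m) - int (y div m)) = 0"
    using arg_cong[OF assms(1), of int] arg_cong[OF assms(2), of int]
    by (simp add: symbol_def algebra_simps)
  then have "x div m = y div m"
    using assms(3) by simp
  then show ?thesis
    using assms(1) unfolding symbol_def by (metis add_right_cancel div_mult_mod_eq)
qed

lemma row_less:
  assumes "code_inv N q L \<mu>" "f < q * L" "x \<le> n"
  shows "row N \<mu> (f mod L) (symbol (f div L) x) < q"
  using assms symbol_less[of x "f div L"] L_pos
  by (simp add: code_inv_def less_mult_imp_div_less)

lemma wp_output_prog:
  assumes env: "env s" and regs: "regs s 0 = n" "regs s 4 = m" and out: "outp s = []"
    and inv: "code_inv N q L (mem s)"
    and post: "\<And>s' t'. outp s' = tables n (map (splitter_fun (mem s)) [0..<q * L]) \<Longrightarrow>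
      t' \<le> t + q * L * (10 * n + 8) + 3 \<Longrightarrow> Q s' t'"
  shows "wp \<delta> M output_prog Q s t"
proof -
  let ?h = "splitter_fun (mem s)"
  let ?base = "\<lambda>s'. mem s' = mem s \<and> env s' \<and> regs s' 0 = n \<and> regs s' 4 = m \<and> regs s' 27 = q * L"
  let ?I = "\<lambda>f s'. ?base s' \<and> regs s' 26 = f \<and> outp s' = tables n (map ?h [0..<f])"
  note bounds = word_bounds
  show ?thesis
    unfolding output_prog_def
  proof (simp, intro conjI, goal_cases)
    case 2
    show ?case
    proof (rule wp_While[where I = ?I and e = "q * L" and c = "10 * n + 7"], goal_cases)
      case 1
      then show ?case using env regs out by (simp add: env_def tables_def)
    next
      case (3 f s1 t1)
      then have f: "f < q * L" by simp
      have j: "f mod L < L" and i: "f div L < q"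
        using L_pos f by (simp_all add: less_mult_imp_div_less)
      have le: "f div L \<le> M" "f mod L \<le> M" "N + f mod L \<le> M" "(N + f mod L) * N \<le> M"
      proof -
        show "(N + f mod L) * N \<le> M"
          using row_cell_less[OF j N] by simp
        moreover have "N + f mod L \<le> (N + f mod L) * N"
          using N by simp
        ultimately show "N + f mod L \<le> M" by linarith
        then show "f mod L \<le> M" by linarith
        show "f div L \<le> M" using i q(2) by linarith
      qed
      let ?J = "\<lambda>x s'. ?base s' \<and> regs s' 26 = f \<and> regs s' 28 = f div L \<and>
        regs s' 29 = (N + f mod L) * N \<and> regs s' 30 = x \<and>
        outp s' = tables n (map ?h [0..<f]) @ map (?h f) [1..<Suc x]"
      from 3 show ?case
      proof (simp add: env_def le, goal_cases)
        case 1
        show ?case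
        proof (rule wp_While[where I = ?J and e = n and c = 9], goal_cases)
          case 1
          then show ?case using 3 by (simp add: env_def)
        next
          case (3 x s2 t2)
          have x: "Suc x \<le> n" using 3 by simp
          have sym: "symbol (f div L) (Suc x) < N"
            using symbol_less[OF x i] .
          \<comment> \<open>The intermediate results of the address computation are summands of a
            symbol, so they fit into words.\<close>
          have "Suc x mod m < N" "f div L * (Suc x div m) < N"
            using sym unfolding symbol_def by linarith+
          moreover have "Suc x div m \<le> n"
            using x by (meson div_le_dividend le_trans)
          moreover have "(N + f mod L) * N + symbol (f div L) (Suc x) < M"
            using row_cell_less[OF j sym] .
          moreover have "row N (mem s) (f mod L) (symbol (f div L) (Suc x)) < q"
            using row_less[OF inv f x] .
          moreover have "?h f (Suc x) = Suc (row N (mem s) (f mod L) (symbol (f div L) (Suc x)))"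
            using x by (simp add: splitter_fun_def)
          moreover have "x < M" "n \<le> M"
            using x bounds(10) by linarith+
          ultimately show ?case
            using 3 sym q(2) N_less_M
            by (simp add: env_def row_def symbol_def)
        next
          case (4 s2 t2)
          then have "Suc f \<le> M"
            using f bounds(5) by linarith
          then show ?case
            using 4 3 by (simp add: env_def tables_def)
        qed (use 3 in \<open>simp\<close>)
      qed
    next
      case (4 s1 t1)
      then show ?case by (intro post) (simp_all add: add.commute)
    qed (use env in \<open>simp add: env_def\<close>)
  qed (use env bounds in \<open>simp_all add: env_def\<close>)
qed

section \<open>Collisions and balance\<close>

lemma card_collisions_le:
  assumes inv: "code_inv N q L \<mu>" and xy: "x \<in> {1..n}" "y \<in> {1..n}" "x \<noteq> y"
  shows "card {f. f < q * L \<and> splitter_fun \<mu> f x = splitter_fun \<mu> f y} \<le> 3 * L"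
proof -
  \<comment> \<open>\<open>E\<close> holds the slopes at which the symbols already collide: at most
    one, spoiling \<open>L\<close> functions. For any other slope \<open>i\<close> the symbols
    differ and at most \<open>10 * l\<close> rows in \<open>A i\<close> merge them, in all
    \<open>q * (10 * l) = 2 * L\<close>.\<close>
  define E where "E = {i. i < q \<and> symbol i x = symbol i y}"
  define A where "A i = {j. j < L \<and> row N \<mu> j (symbol i x) = row N \<mu> j (symbol i y)}" for i
  have finE: "finite E" and finA: "finite (A i)" for i
    by (simp_all add: E_def A_def)
  have cardE: "card E \<le> 1"
    using symbol_inj[of _ x y] xy(3) finE by (auto simp: card_le_Suc0_iff_eq E_def)
  have cardA: "card (A i) \<le> 10 * l" if "i \<in> {..<q} - E" for i
    using code_inv_agreements[OF inv[unfolded L_def] N_le_power q(1), of "symbol i x" "symbol i y"]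
      that symbol_less xy by (simp add: A_def E_def L_def)
  have "card {f. f < q * L \<and> splitter_fun \<mu> f x = splitter_fun \<mu> f y}
      \<le> card (E \<times> {..<L} \<union> Sigma ({..<q} - E) A)"
  proof (rule card_inj_on_le)
    show "inj_on (\<lambda>f. (f div L, f mod L)) {f. f < q * L \<and> splitter_fun \<mu> f x = splitter_fun \<mu> f y}"
      by (intro inj_onI) (metis div_mult_mod_eq prod.inject)
    show "(\<lambda>f. (f div L, f mod L)) ` {f. f < q * L \<and> splitter_fun \<mu> f x = splitter_fun \<mu> f y}
        \<subseteq> E \<times> {..<L} \<union> Sigma ({..<q} - E) A"
      using xy L_pos by (auto simp: splitter_fun_def E_def A_def less_mult_imp_div_less)
  qed (use finE finA in auto)
  also have "\<dots> \<le> card (E \<times> {..<L}) + card (Sigma ({..<q} - E) A)"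
    by (rule card_Un_le)
  also have "card (E \<times> {..<L}) \<le> L"
    using mult_le_mono1[OF cardE, of L] unfolding card_cartesian_product card_lessThan mult_1 .
  also have "card (Sigma ({..<q} - E) A) = (\<Sum>i\<in>{..<q} - E. card (A i))"
    using finA by simp
  also have "\<dots> \<le> (\<Sum>i\<in>{..<q} - E. 10 * l)"
    by (intro sum_mono cardA)
  also have "\<dots> \<le> q * (10 * l)"
    using card_mono[of "{..<q}" "{..<q} - E"] by simp
  also have "q * (10 * l) = 2 * L"
    by (simp add: L_def)
  finally show ?thesis by simp
qed

lemma split_splitter_fun:
  "split (mset (map (splitter_fun \<mu>) [0..<q * L])) S = card {f. f < q * L \<and> inj_on (splitter_fun \<mu> f) S}"
proof -
  have "split (mset (map (splitter_fun \<mu>) [0..<q * L])) S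
      = length (filter (\<lambda>h. inj_on h S) (map (splitter_fun \<mu>) [0..<q * L]))"
    unfolding split_def by (metis mset_filter size_mset)
  also have "\<dots> = card {f. f < q * L \<and> inj_on (splitter_fun \<mu> f) S}"
    unfolding length_filter_conv_card by (intro arg_cong[where f = card]) auto
  finally show ?thesis .
qed

text \<open>A union bound over the pairs in \<open>S\<close>. The inequality is doubled to avoid
  halving the number of pairs.\<close>

lemma card_not_inj_le:
  assumes inv: "code_inv N q L \<mu>" and S: "S \<subseteq> {1..n}" "card S = k"
  shows "2 * card {f. f < q * L \<and> \<not> inj_on (splitter_fun \<mu> f) S} \<le> k ^ 2 * (3 * L)"
proof -
  define P where "P = {(x, y). x \<in> S \<and> y \<in> S \<and> x < y}"
  define C where "C = (\<lambda>(x, y). {f. f < q * L \<and> splitter_fun \<mu> f x = splitter_fun \<mu> f y})"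
  have finS: "finite S"
    using S(1) finite_subset by blast
  have PS: "P \<subseteq> S \<times> S"
    by (auto simp: P_def)
  then have finP: "finite P"
    using finS finite_subset by blast
  \<comment> \<open>\<open>P\<close> and its mirror image are disjoint subsets of
    \<open>S \<times> S\<close>.\<close>
  have "2 * card P = card P + card (prod.swap ` P)"
    by (simp add: card_image)
  also have "\<dots> = card (P \<union> prod.swap ` P)"
    using finP by (subst card_Un_disjoint) (auto simp: P_def)
  also have "\<dots> \<le> card (S \<times> S)"
    using finS PS by (intro card_mono) auto
  finally have cardP: "2 * card P \<le> k ^ 2"
    using S(2) by (simp add: card_cartesian_product power2_eq_square)
  have "{f. f < q * L \<and> \<not> inj_on (splitter_fun \<mu> f) S} \<subseteq> (\<Union>p\<in>P. C p)"
  proof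
    fix f assume f: "f \<in> {f. f < q * L \<and> \<not> inj_on (splitter_fun \<mu> f) S}"
    then obtain x y where "x \<in> S" "y \<in> S" "x \<noteq> y" "splitter_fun \<mu> f x = splitter_fun \<mu> f y"
      by (auto simp: inj_on_def)
    then have "(min x y, max x y) \<in> P" "f \<in> C (min x y, max x y)"
      using f by (auto simp: P_def C_def min_def max_def)
    then show "f \<in> (\<Union>p\<in>P. C p)"
      by blast
  qed
  then have "card {f. f < q * L \<and> \<not> inj_on (splitter_fun \<mu> f) S} \<le> card (\<Union>p\<in>P. C p)"
    using finP by (intro card_mono) (auto simp: C_def)
  also have "\<dots> \<le> (\<Sum>p\<in>P. card (C p))"
    by (rule card_UN_le[OF finP])
  also have "\<dots> \<le> (\<Sum>p\<in>P. 3 * L)"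
    unfolding C_def
  proof (intro sum_mono, clarify)
    fix x y assume "(x, y) \<in> P"
    then show "card {f. f < q * L \<and> splitter_fun \<mu> f x = splitter_fun \<mu> f y} \<le> 3 * L"
      using S(1) by (intro card_collisions_le[OF inv]) (auto simp: P_def)
  qed
  finally have "2 * card {f. f < q * L \<and> \<not> inj_on (splitter_fun \<mu> f) S} \<le> (2 * card P) * (3 * L)"
    by simp
  also have "\<dots> \<le> k ^ 2 * (3 * L)"
    using cardP by (rule mult_le_mono1)
  finally show ?thesis .
qed

text \<open>With \<open>T = q * L / \<delta>\<close> the upper bound \<open>\<delta> * T\<close> is
  the number of all functions, hence trivial. The lower bound asks that a fraction of at most
  \<open>1 - 1 / \<delta> ^ 2\<close> of the functions fail on \<open>S\<close>.\<close>

lemma balanced_splitter_fun: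
  assumes inv: "code_inv N q L \<mu>"
  shows "balanced_splitter \<delta> n k q (mset (map (splitter_fun \<mu>) [0..<q * L]))"
proof -
  let ?H = "mset (map (splitter_fun \<mu>) [0..<q * L])"
  have "k \<le> k ^ 2" using k by (simp add: power2_eq_square)
  then have k_le_q: "k \<le> q"
    using two_k2_le_q by linarith
  have range: "splitter_fun \<mu> f \<in> {1..n} \<rightarrow>\<^sub>E {1..q}" if "f < q * L" for f
    using row_less[OF inv that] by (auto simp: splitter_fun_def Suc_le_eq)
  have balance: "real q * real L / \<delta> / \<delta> \<le> real (split ?H S) \<and> real (split ?H S) \<le> \<delta> * (real q * real L / \<delta>)"
    if S: "S \<subseteq> {1..n}" "card S = k" for S
  proof -
    let ?good = "{f. f < q * L \<and> inj_on (splitter_fun \<mu> f) S}"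
    let ?bad = "{f. f < q * L \<and> \<not> inj_on (splitter_fun \<mu> f) S}"
    have "card ?good + card ?bad = card (?good \<union> ?bad)"
      by (subst card_Un_disjoint) auto
    also have "?good \<union> ?bad = {..<q * L}"
      by auto
    finally have sum: "card ?good + card ?bad = q * L"
      by simp
    have bad: "2 * real (card ?bad) \<le> real k ^ 2 * (3 * real L)"
      using of_nat_mono[OF card_not_inj_le[OF inv S], where 'a = real] by simp
    have "2 * real k ^ 2 \<le> real q * (\<delta> - 1)"
      using q_ge \<delta> by (simp add: pos_divide_le_eq)
    then have "3 * real k ^ 2 / 2 \<le> 3 / 4 * (real q * (\<delta> - 1))"
      by linarith
    also have "\<dots> = real q * (3 / 4 * (\<delta> - 1))"
      by simp
    also have "3 / 4 * (\<delta> - 1) \<le> 1 - 1 / \<delta> ^ 2"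
    proof -
      \<comment> \<open>The two sides agree at \<open>\<delta> = 1\<close> and
        \<open>\<delta> = 2\<close>, which yields these factors of the difference multiplied by
        \<open>4 * \<delta> ^ 2\<close>.\<close>
      have "0 \<le> (\<delta> - 1) * ((3 * \<delta> + 2) * (2 - \<delta>))"
        using \<delta> by (intro mult_nonneg_nonneg) auto
      also have "\<dots> = 4 * (\<delta> ^ 2 - 1 - 3 / 4 * (\<delta> - 1) * \<delta> ^ 2)"
        by (simp add: field_simps power2_eq_square)
      finally have "3 / 4 * (\<delta> - 1) * \<delta> ^ 2 \<le> \<delta> ^ 2 - 1"
        by simp
      then have "3 / 4 * (\<delta> - 1) \<le> (\<delta> ^ 2 - 1) / \<delta> ^ 2"
        using \<delta> by (simp add: pos_le_divide_eq)
      then show ?thesis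
        using \<delta> by (simp add: diff_divide_distrib)
    qed
    finally have "3 * real k ^ 2 / 2 \<le> real q * (1 - 1 / \<delta> ^ 2)"
      by (simp add: mult_left_mono)
    then have "3 * real k ^ 2 / 2 * real L \<le> real q * (1 - 1 / \<delta> ^ 2) * real L"
      by (rule mult_right_mono) simp
    also have "\<dots> = real q * real L - real q * real L / \<delta> / \<delta>"
      by (simp add: left_diff_distrib right_diff_distrib power2_eq_square)
    finally have "real q * real L / \<delta> / \<delta> \<le> real q * real L - real (card ?bad)"
      using bad by simp
    moreover have "real (card ?good) + real (card ?bad) = real q * real L"
      using arg_cong[OF sum, of real] by simp
    moreover have "\<delta> * (real q * real L / \<delta>) = real q * real L"
      using \<delta> by simp
    ultimately show ?thesis
      unfolding split_splitter_fun by linarith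
  qed
  show ?thesis
    unfolding balanced_splitter_def
  proof (intro conjI exI[of _ "real q * real L / \<delta>"] allI impI)
    show "set_mset ?H \<subseteq> {1..n} \<rightarrow>\<^sub>E {1..q}"
      using range by (simp add: image_subset_iff)
    show "0 < real q * real L / \<delta>"
      using \<delta> q(1) L_pos by simp
    show "1 \<le> \<delta>" using \<delta> by simp
    show "k \<le> q" by (rule k_le_q)
    fix S assume S: "S \<subseteq> {1..n} \<and> card S = k"
    show "real q * real L / \<delta> / \<delta> \<le> real (split ?H S)"
      and "real (split ?H S) \<le> \<delta> * (real q * real L / \<delta>)"
      using balance[of S] S by blast+
  qed
qed

section \<open>Bounds on time and size\<close>

lemma time_le:
  "4 * q + 3 * m + 3 * l + 16 + (L * (N * (q * (11 * N + 9) + 12 * N + 8) + 6) + 2) + (q * L * (10 * n + 8) + 3)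
    \<le> 1000 * (q ^ 4 * n * l)"
proof -
  have n: "1 \<le> n" and q1: "1 \<le> q" and l1: "1 \<le> l" and N1: "1 \<le> N"
    using k q_ge_2 l_pos N_ge_4 by linarith+
  have pos: "1 \<le> q ^ i" for i using q1 by simp
  have "m \<le> 2 * n"
    using m_le n by linarith
  have "q * (11 * N + 9) + 12 * N + 8 = 11 * (q * N) + 9 * (q * 1) + 12 * (1 * N) + 8 * (1 * 1)"
    by (simp add: algebra_simps)
  also have "\<dots> \<le> 11 * (q * N) + 9 * (q * N) + 12 * (q * N) + 8 * (q * N)"
    by (intro add_mono mult_le_mono q1 N1 order_refl)
  finally have "N * (q * (11 * N + 9) + 12 * N + 8) \<le> N * (40 * q * N)"
    by (intro mult_le_mono2) simp
  \<comment> \<open>One row costs on the order of \<open>q * N * N\<close>, which is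
    \<open>q ^ 3 * (m * m)\<close> and so linear in \<open>n\<close>.\<close>
  also have "\<dots> = 40 * q ^ 3 * (m * m)"
    by (simp add: N_def power3_eq_cube)
  also have "\<dots> \<le> 40 * q ^ 3 * (4 * n)"
    by (intro mult_le_mono2 m_square_le)
  also have "\<dots> = 160 * (q ^ 3 * n)"
    by simp
  finally have "N * (q * (11 * N + 9) + 12 * N + 8) \<le> 160 * (q ^ 3 * n)" .
  moreover have "1 * 1 \<le> q ^ 3 * n"
    by (intro mult_le_mono pos n)
  ultimately have row: "N * (q * (11 * N + 9) + 12 * N + 8) + 6 \<le> 166 * (q ^ 3 * n)"
    by linarith
  have "L * (N * (q * (11 * N + 9) + 12 * N + 8) + 6) \<le> L * (166 * (q ^ 3 * n))"
    by (intro mult_le_mono2 row)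
  also have "\<dots> = 830 * (q ^ 4 * n * l)"
    by (simp add: L_def power3_eq_cube power4_eq_xxxx)
  finally have code: "L * (N * (q * (11 * N + 9) + 12 * N + 8) + 6) \<le> 830 * (q ^ 4 * n * l)" .
  have "q * L * (10 * n + 8) \<le> q * L * (18 * n)"
    using n by (intro mult_le_mono2) simp
  also have "\<dots> = 90 * (q ^ 2 * n * l)"
    by (simp add: L_def power2_eq_square)
  also have "\<dots> \<le> 90 * (q ^ 4 * n * l)"
    using q1 by (intro mult_le_mono power_increasing) auto
  finally have out: "q * L * (10 * n + 8) \<le> 90 * (q ^ 4 * n * l)" .
  have q4: "q \<le> q ^ 4"
    using power_increasing[of 1 4 q] q1 by simp
  have "q * 1 * 1 \<le> q ^ 4 * n * l" "1 * n * 1 \<le> q ^ 4 * n * l" "1 * 1 * l \<le> q ^ 4 * n * l"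
    by (intro mult_le_mono q4 n l1 pos order_refl)+
  then show ?thesis
    using code out \<open>m \<le> 2 * n\<close> n unfolding mult_1 mult_1_right by linarith
qed

text \<open>From \<open>2 ^ l < 2 * N \<le> 2 * q * (n + 1)\<close>. The logarithm of
  \<open>2 * q\<close> is crudely bounded by \<open>2 * q\<close>, and
  \<open>ln (n + 1) \<ge> 1 / 2\<close> turns the sum into a product, at the price of one more
  factor \<open>q\<close>.\<close>

lemma l_le: "real l \<le> 10 * real q * ln (real n + 1)"
proof -
  have "ln (1 / 2 :: real) \<le> 1 / 2 - 1"
    by (rule ln_le_minus_one) simp
  then have ln2: "1 / 2 \<le> ln (2::real)"
    by (simp add: ln_div)
  have "ln 2 \<le> ln (real n + 1)"
    using k by simp
  then have ln_n: "1 / 2 \<le> ln (real n + 1)"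
    using ln2 by linarith
  have "2 ^ l \<le> 2 * q * Suc n"
    using power_l_less m_le mult_le_mono2[of m "Suc n" "2 * q"] by (simp add: N_def)
  then have "real (2 ^ l) \<le> real (2 * q * Suc n)"
    by (simp only: of_nat_le_iff)
  then have "2 ^ l \<le> 2 * real q * (real n + 1)"
    by (simp add: algebra_simps)
  moreover have "0 < 2 * real q * (real n + 1)"
    using q_ge_2 by (intro mult_pos_pos) auto
  ultimately have "ln (2 ^ l) \<le> ln (2 * real q * (real n + 1))"
    by (subst ln_le_cancel_iff) auto
  also have "\<dots> = ln (2 * real q) + ln (real n + 1)"
    using q_ge_2 by (simp add: ln_mult)
  also have "\<dots> \<le> 2 * real q * 1 + 1 * ln (real n + 1)"
    using ln_le_minus_one[of "2 * real q"] q_ge_2 by simp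
  also have "\<dots> \<le> 2 * real q * (2 * ln (real n + 1)) + real q * ln (real n + 1)"
    using ln_n q_ge_2 by (intro add_mono mult_left_mono mult_right_mono) auto
  finally have "real l * ln 2 \<le> 5 * real q * ln (real n + 1)"
    by (simp add: ln_realpow)
  moreover have "real l * (1 / 2) \<le> real l * ln 2"
    by (intro mult_left_mono ln2) simp
  ultimately show ?thesis by simp
qed

lemma q_power_le: "real q ^ i \<le> 3 ^ i * real k ^ (2 * i) / (\<delta> - 1) ^ i"
  using power_mono[OF q_le, of i] by (simp add: power_mult power_divide power_mult_distrib)

lemma splitter_prog_correct:
  obtains H t where "balanced_splitter \<delta> n k q H" "size H = q * L"
    "constructs splitter_prog M n k \<delta> H t" "t \<le> 1000 * (q ^ 4 * n * l)"
proof -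
  have "wp \<delta> M splitter_prog
    (\<lambda>s t. t \<le> 1000 * (q ^ 4 * n * l) \<and> (\<exists>\<mu>. code_inv N q L \<mu> \<and>
      outp s = tables n (map (splitter_fun \<mu>) [0..<q * L]))) (init_state n k) 0"
    unfolding splitter_prog_def wp_Seq
  proof (rule wp_params_prog, rule wp_code_prog)
    fix s1 t1 s2 t2
    assume 1: "env s1" "regs s1 0 = n" "regs s1 4 = m" "outp s1 = []"
        "t1 \<le> 4 * q + 3 * m + 3 * l + 16"
      and 2: "code_inv N q L (mem s2)" "outp s2 = outp s1" "frame {10..19} s1 s2"
        "t2 \<le> t1 + L * (N * (q * (11 * N + 9) + 12 * N + 8) + 6) + 2"
    show "wp \<delta> M output_prog
      (\<lambda>s t. t \<le> 1000 * (q ^ 4 * n * l) \<and> (\<exists>\<mu>. code_inv N q L \<mu> \<and>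
        outp s = tables n (map (splitter_fun \<mu>) [0..<q * L]))) s2 t2"
    proof (rule wp_output_prog[OF _ _ _ _ 2(1)])
      fix s' t'
      assume out: "outp s' = tables n (map (splitter_fun (mem s2)) [0..<q * L])"
        and "t' \<le> t2 + q * L * (10 * n + 8) + 3"
      then have "t' \<le> 1000 * (q ^ 4 * n * l)"
        using 1(5) 2(4) time_le by linarith
      then show "t' \<le> 1000 * (q ^ 4 * n * l) \<and> (\<exists>\<mu>. code_inv N q L \<mu> \<and>
          outp s' = tables n (map (splitter_fun \<mu>) [0..<q * L]))"
        using out 2(1) by blast
    qed (use 1 2 in \<open>auto simp: env_def frame_def\<close>)
  next
    fix j \<mu> assume "j \<le> L" "code_inv N q j \<mu>"
    then have "total N \<mu> N \<le> 2 ^ (10 * l)"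
      using code_inv_total_le[of N q j \<mu> l] N_le_power q(1) by (simp add: L_def)
    then show "2 * total N \<mu> N \<le> M"
      using word_bounds(7) by linarith
  qed (auto simp: code_inv_0)
  then obtain s t \<mu> where *: "exec \<delta> M splitter_prog (init_state n k) t s" "t \<le> 1000 * (q ^ 4 * n * l)"
      "code_inv N q L \<mu>" "outp s = tables n (map (splitter_fun \<mu>) [0..<q * L])"
    unfolding wp_def by auto
  show ?thesis
  proof
    show "balanced_splitter \<delta> n k q (mset (map (splitter_fun \<mu>) [0..<q * L]))"
      by (rule balanced_splitter_fun) fact
    show "constructs splitter_prog M n k \<delta> (mset (map (splitter_fun \<mu>) [0..<q * L])) t"
      unfolding constructs_def using *(1,4) by blast
  qed (use * in simp_all)
qed

end

theorem theorem5:
  "\<exists>(p::com) (d::nat) (C::real) (a::nat) (b::nat) (C'::real) (a'::nat) (b'::nat).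
     \<forall>(n::nat) (k::nat) (\<delta>::real) (q::nat).
       1 \<le> k \<and> k \<le> n \<and> 1 < \<delta> \<and> \<delta> \<le> 2 \<and> q = nat \<lceil>2 * real k ^ 2 / (\<delta> - 1)\<rceil> \<longrightarrow>
       (\<exists>H t. balanced_splitter \<delta> n k q H \<and>
          real (size H) \<le> C * real k ^ a * ln (real n + 1) / (\<delta> - 1) ^ b \<and>
          constructs p ((n + q) ^ d) n k \<delta> H t \<and>
          real t \<le> C' * real k ^ a' * real n * ln (real n + 1) / (\<delta> - 1) ^ b')"
proof -
  \<comment> \<open>The size is \<open>5 * q ^ 2 * l\<close> and the time at most
    \<open>1000 * q ^ 4 * n * l\<close>. Inserting the bounds on \<open>l\<close> and
    \<open>q\<close> gives \<open>1350 = 50 * 3 ^ 3\<close> and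
    \<open>2430000 = 10000 * 3 ^ 5\<close>.\<close>
  have "\<exists>H t. balanced_splitter \<delta> n k q H \<and>
      real (size H) \<le> 1350 * real k ^ 6 * ln (real n + 1) / (\<delta> - 1) ^ 3 \<and>
      constructs splitter_prog ((n + q) ^ 40) n k \<delta> H t \<and>
      real t \<le> 2430000 * real k ^ 10 * real n * ln (real n + 1) / (\<delta> - 1) ^ 5"
    if "1 \<le> k" "k \<le> n" "1 < \<delta>" "\<delta> \<le> 2" "q = nat \<lceil>2 * real k ^ 2 / (\<delta> - 1)\<rceil>" for n k q \<delta>
  proof -
    interpret splitter_params \<delta> n k q
      by unfold_locales (fact that)+
    obtain H t where *: "balanced_splitter \<delta> n k q H" "size H = q * L"
      "constructs splitter_prog M n k \<delta> H t" "t \<le> 1000 * (q ^ 4 * n * l)"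
      by (rule splitter_prog_correct)
    have ln: "0 \<le> ln (real n + 1)"
      by simp
    have "real (size H) = 5 * real q ^ 2 * real l"
      by (simp add: *(2) L_def power2_eq_square)
    also have "\<dots> \<le> 5 * real q ^ 2 * (10 * real q * ln (real n + 1))"
      by (intro mult_left_mono l_le) simp
    also have "\<dots> = 50 * real q ^ 3 * ln (real n + 1)"
      by (simp add: eval_nat_numeral)
    also have "\<dots> \<le> 50 * (3 ^ 3 * real k ^ (2 * 3) / (\<delta> - 1) ^ 3) * ln (real n + 1)"
      by (intro mult_left_mono mult_right_mono q_power_le ln) simp
    finally have size: "real (size H) \<le> 1350 * real k ^ 6 * ln (real n + 1) / (\<delta> - 1) ^ 3"
      by simp
    have "real t \<le> real (1000 * (q ^ 4 * n * l))"
      using *(4) by (simp only: of_nat_le_iff)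
    also have "\<dots> = 1000 * real q ^ 4 * real n * real l"
      by simp
    also have "\<dots> \<le> 1000 * real q ^ 4 * real n * (10 * real q * ln (real n + 1))"
      by (intro mult_left_mono l_le) simp
    also have "\<dots> = 10000 * real q ^ 5 * (real n * ln (real n + 1))"
      by (simp add: eval_nat_numeral)
    also have "\<dots> \<le> 10000 * (3 ^ 5 * real k ^ (2 * 5) / (\<delta> - 1) ^ 5) * (real n * ln (real n + 1))"
      by (intro mult_left_mono mult_right_mono q_power_le mult_nonneg_nonneg ln) simp_all
    finally have "real t \<le> 2430000 * real k ^ 10 * real n * ln (real n + 1) / (\<delta> - 1) ^ 5"
      by simp
    with * size show ?thesis by blast
  qed
  then show ?thesis by blast
qed

end
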